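(* Let $c=(c_1,c_2)$ be a constant in $\mathbb{C}^2$, let $m,n$ be two positive integers, and let $I=(\alpha_1,\alpha_2)$ and $J=(\beta_1,\beta_2)$ be two multi-indices of non-negative integers. Consider the Fermat-type partial differential-difference equation $$\left(\partial^{I}f(z_1,z_2)+\partial^{J}f(z_1,z_2)\right)^n+f^m(z_1+c_1,z_2+c_2)=1 .$$ If one of the following conditions holds: (i) $m>n$; (ii) $n>m\geq 2$, then this equation does not have any finite order transcendental entire solution $f$ on $\mathbb{C}^2$.
   Context: For multi-indices $I=(\alpha_1,\alpha_2)$, $J=(\beta_1,\beta_2)$ with lengths $|I|=\alpha_1+\alpha_2$, $|J|=\beta_1+\beta_2$, $$\partial^{I}f(z_1,z_2)=\frac{\partial^{|I|}f(z_1,z_2)}{\partial z_1^{\alpha_1}\partial z_2^{\alpha_2}},\qquad \partial^{J}f(z_1,z_2)=\frac{\partial^{|J|}f(z_1,z_2)}{\partial z_1^{\beta_1}\partial z_2^{\beta_2}}.$$ Here $f^m(z_1+c_1,z_2+c_2)$ means $\left(f(z_1+c_1,z_2+c_2)\right)^m$. An entire function on $\mathbb{C}^2$ is transcendental if it is not a polynomial; it has finite order if $\limsup_{r\to\infty}\frac{\log^+T(r,f)}{\log r}<\infty$, where $T(r,f)$ is the Nevanlinna characteristic function on $\mathbb{C}^2$. *)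

theory Defs
  imports "HOL-Analysis.Analysis"
begin

definition entire2 :: "(complex \<times> complex \<Rightarrow> complex) \<Rightarrow> bool" where
  "entire2 f \<longleftrightarrow> (\<forall>z. \<exists>a b. (f has_derivative (\<lambda>(u, v). a * u + b * v)) (at z))"

definition polynomial2 :: "(complex \<times> complex \<Rightarrow> complex) \<Rightarrow> bool" where
  "polynomial2 f \<longleftrightarrow>
     (\<exists>(d::nat) (a :: nat \<Rightarrow> nat \<Rightarrow> complex). \<forall>z1 z2.
        f (z1, z2) = (\<Sum>i\<le>d. \<Sum>j\<le>d. a i j * z1 ^ i * z2 ^ j))"

definition transcendental_entire2 :: "(complex \<times> complex \<Rightarrow> complex) \<Rightarrow> bool" where
  "transcendental_entire2 f \<longleftrightarrow> entire2 f \<and> \<not> polynomial2 f"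

definition partial1 :: "(complex \<times> complex \<Rightarrow> complex) \<Rightarrow> complex \<times> complex \<Rightarrow> complex" where
  "partial1 f = (\<lambda>(z1, z2). deriv (\<lambda>w. f (w, z2)) z1)"

definition partial2 :: "(complex \<times> complex \<Rightarrow> complex) \<Rightarrow> complex \<times> complex \<Rightarrow> complex" where
  "partial2 f = (\<lambda>(z1, z2). deriv (\<lambda>w. f (z1, w)) z2)"

definition partial_deriv ::
    "nat \<times> nat \<Rightarrow> (complex \<times> complex \<Rightarrow> complex) \<Rightarrow> complex \<times> complex \<Rightarrow> complex" where
  "partial_deriv I f = (partial1 ^^ fst I) ((partial2 ^^ snd I) f)"

text \<open>
  The normalised surface measure on the unit sphere of \<open>\<complex>\<^sup>2\<close> (the form
  \<open>d\<^sup>c log |z|\<^sup>2 \<and> dd\<^sup>c log |z|\<^sup>2\<close>, scaled to total mass 1), obtained by projecting the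
  uniform distribution on the unit ball radially; the norm on \<open>\<complex> \<times> \<complex>\<close> is the Euclidean one.
  The origin, which is not mapped to the sphere, is a null set.
\<close>

definition unit_sphere_measure :: "(complex \<times> complex) measure" where
  "unit_sphere_measure =
     distr (uniform_measure lborel (ball 0 1)) borel (\<lambda>z. z /\<^sub>R norm z)"

lemma emeasure_unit_sphere_measure: "emeasure unit_sphere_measure (sphere 0 1) = 1"
proof -
  let ?B = "ball 0 1 :: (complex \<times> complex) set"
  let ?p = "\<lambda>z :: complex \<times> complex. z /\<^sub>R norm z"
  have m: "?p \<in> measurable (uniform_measure lborel ?B) borel"
    by measurable
  have s: "sphere 0 1 \<in> sets (borel :: (complex \<times> complex) measure)"
    by (intro borel_closed closed_sphere)
  have v: "?p -` sphere 0 1 = - {0}"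
  proof (rule set_eqI)
    show "z \<in> ?p -` sphere 0 1 \<longleftrightarrow> z \<in> - {0}" for z
      by (cases "z = 0") (simp_all del: split_paired_All)
  qed
  have b0: "emeasure lborel ?B \<noteq> 0"
    using content_ball_pos[of 1 "0 :: complex \<times> complex"]
    by (simp add: measure_def zero_less_iff_neq_zero enn2real_positive_iff)
  have "emeasure lborel (?B \<inter> - {0}) = emeasure lborel (?B - {0})"
    by (simp add: Diff_eq)
  also have "\<dots> = emeasure lborel ?B"
    by (rule emeasure_Diff_null_set) (auto simp: null_sets_def)
  finally have e: "emeasure lborel (?B \<inter> - {0}) = emeasure lborel ?B" .
  show ?thesis
    using b0 emeasure_lborel_ball_finite[of "0 :: complex \<times> complex" 1]
    by (simp add: unit_sphere_measure_def emeasure_distr[OF m s] v e ennreal_divide_self)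
qed

text \<open>Since \<open>ln 0 = 0\<close>, this also gives the usual value 0 at \<open>x = 0\<close>.\<close>

definition log_plus :: "real \<Rightarrow> real" where
  "log_plus x = max 0 (ln x)"

text \<open>
  The Nevanlinna characteristic is \<open>T(r, f) = N(r, f) + m(r, f)\<close>, with \<open>N\<close> the integrated counting
  function of the poles and \<open>m\<close> the proximity function, the mean of \<open>log\<^sup>+ |f|\<close> over the sphere
  \<open>|z| = r\<close>. An entire function has no poles, so only \<open>m(r, f)\<close> remains; the definition is meant
  for entire \<open>f\<close> and \<open>r > 0\<close>.
\<close>

definition nevanlinna_T :: "real \<Rightarrow> (complex \<times> complex \<Rightarrow> complex) \<Rightarrow> real" where
  "nevanlinna_T r f = (\<integral>z. log_plus (norm (f (r *\<^sub>R z))) \<partial>unit_sphere_measure)"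

definition finite_order :: "(complex \<times> complex \<Rightarrow> complex) \<Rightarrow> bool" where
  "finite_order f \<longleftrightarrow>
     Limsup at_top (\<lambda>r. ereal (log_plus (nevanlinna_T r f) / ln r)) < \<infinity>"

end

theory Submission
  imports Defs "HOL-Complex_Analysis.Complex_Analysis" "HOL-Real_Asymp.Real_Asymp"
begin

text \<open>
  Case \<open>m > n\<close>. By Cauchy's estimates \<open>|f(z)|\<^sup>m \<le> 1 + (2 |f(z')|)\<^sup>n\<close> for some \<open>z'\<close> with
  \<open>|z'| \<le> |z| + d\<close>. Iterating from a point where \<open>|f|\<close> is large makes \<open>log |f|\<close> grow geometrically
  along points of linearly growing norm. On the other hand \<open>log\<^sup>+ |f|\<close> is subharmonic, so it is bounded
  by its means over balls and hence by the Nevanlinna characteristic, which finite order bounds by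
  a power of \<open>r\<close>.

  Case \<open>n > m \<ge> 2\<close>. On every complex line the equation becomes \<open>g\<^sup>n + h\<^sup>m = 1\<close> with \<open>g\<close>, \<open>h\<close> entire in
  one variable and \<open>n \<ge> 3\<close>. Each \<open>1 - u g\<close> with \<open>u\<^sup>n = 1\<close> is the \<open>m\<close>-th power of an entire function, since
  it is coprime to its cofactor in \<open>1 - g\<^sup>n = h\<^sup>m\<close>. Differences of these \<open>m\<close>-th powers (suitably
  scaled) are constant, so their linear factors have no zeros, and ratios of such factors omit two
  values; Picard's theorem makes everything constant.
\<close>

section \<open>Entire solutions of \<open>g\<^sup>n + h\<^sup>m = 1\<close> in one variable\<close>

lemma entire_power_const_imp_const:
  fixes b :: "complex \<Rightarrow> complex"
  assumes "b holomorphic_on UNIV" "m \<ge> 1" "\<And>z. b z ^ m = c"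
  shows "b constant_on UNIV"
proof (rule Liouville_theorem[OF assms(1)])
  \<comment> \<open>The summand 1 makes a counterexample have \<open>norm (b z) > 1\<close>, so that
    \<open>norm (b z)\<close> is at most its \<open>m\<close>-th power.\<close>
  have "norm (b z) \<le> norm c + 1" for z
  proof (rule ccontr)
    assume "\<not> norm (b z) \<le> norm c + 1"
    moreover from this have "norm (b z) ^ 1 \<le> norm (b z) ^ m"
      using assms(2) norm_ge_zero[of c] by (intro power_increasing) linarith+
    moreover have "norm (b z) ^ m = norm c"
      by (simp add: assms(3) flip: norm_power)
    ultimately show False by simp
  qed
  thus "bounded (range b)"
    unfolding bounded_iff by blast
qed

text \<open>A Weierstrass product \<open>F\<close> takes up the zeros of \<open>h\<close> lying
  where \<open>q\<close> does not vanish. There \<open>p = h ^ m / q\<close>, so these points are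
  the zeros of \<open>p\<close>, each with \<open>m\<close> times the multiplicity it has for
  \<open>F\<close>. Thus \<open>p / F ^ m\<close> is entire without zeros and has a logarithm, which
  divided by \<open>m\<close> yields the root.\<close>

lemma entire_coprime_factor_of_power:
  fixes p q h :: "complex \<Rightarrow> complex"
  assumes hol: "p holomorphic_on UNIV" "q holomorphic_on UNIV" "h holomorphic_on UNIV"
    and m: "m \<ge> 1" and eq: "\<And>z. p z * q z = h z ^ m"
    and cop: "\<And>z. p z \<noteq> 0 \<or> q z \<noteq> 0" and nz: "h z0 \<noteq> 0"
  obtains a where "a holomorphic_on UNIV" "\<And>z. a z ^ m = p z"
proof -
  define A where "A = {z. q z \<noteq> 0}"
  have contq: "continuous_on UNIV q" and contp: "continuous_on UNIV p"
    using hol holomorphic_on_imp_continuous_on by auto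
  have openA: "open A"
    unfolding A_def by (intro open_Collect_neq contq continuous_intros)
  have z0: "z0 \<in> A"
    using eq[of z0] nz m by (auto simp: A_def power_0_left)
  have connA: "connected A"
  proof (cases "q constant_on UNIV")
    case True
    then have "A = UNIV"
      using z0 by (auto simp: A_def constant_on_def)
    then show ?thesis by (simp add: connected_UNIV)
  next
    case False
    have "countable {z\<in>UNIV. q z = 0}"
      by (rule holomorphic_countable_zeros) (use False hol in auto)
    moreover have "A = UNIV - {z\<in>UNIV. q z = 0}"
      by (auto simp: A_def)
    ultimately show ?thesis
      using connected_open_diff_countable[of "UNIV :: complex set"] by (simp add: connected_UNIV)
  qed
  \<comment> \<open>No accumulation occurs even on the boundary of \<open>A\<close>, because
    \<open>h\<close> is entire. This is why \<open>F\<close> can be holomorphic on the whole plane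
    while \<open>k\<close> lives on \<open>A\<close> only.\<close>
  have "\<not> z islimpt {w \<in> A. h w = 0}" for z
  proof
    assume lim: "z islimpt {w \<in> A. h w = 0}"
    have "h z0 = 0"
      by (rule analytic_continuation[OF hol(3) open_UNIV connected_UNIV subset_UNIV UNIV_I lim]) auto
    with nz show False by contradiction
  qed
  then obtain k F where kF: "k holomorphic_on A" "F holomorphic_on UNIV"
      "\<forall>z. F z = 0 \<longleftrightarrow> (\<forall>z\<in>A. h z = 0) \<or> (z \<in> A \<and> h z = 0)"
      "\<forall>z\<in>A. k z \<noteq> 0" "\<forall>z\<in>A. h z = k z * F z"
    by (rule weierstrass_factorization[OF holomorphic_on_subset[OF hol(3) subset_UNIV] openA connA])
       blast
  have F0: "F z = 0 \<longleftrightarrow> z \<in> A \<and> h z = 0" for z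
    using kF(3) z0 nz by blast
  \<comment> \<open>Coprimality enters here: a zero of \<open>p\<close> lies in \<open>A\<close>, so
    \<open>F\<close> catches it.\<close>
  have pF: "p z = 0 \<Longrightarrow> F z = 0" for z
    using eq[of z] cop[of z] m by (auto simp: F0 A_def)
  define B where "B = {z. F z \<noteq> 0}"
  have contF: "continuous_on UNIV F"
    using kF(2) holomorphic_on_imp_continuous_on by auto
  have openB: "open B"
    unfolding B_def by (intro open_Collect_neq contF continuous_intros)
  \<comment> \<open>This is \<open>p / F ^ m\<close>, continued to the zeros of \<open>F\<close> by
    the equal expression \<open>k ^ m / q\<close>. Those zeros lie in \<open>A\<close>, where
    \<open>p * q = (k * F) ^ m\<close>.\<close>
  define r where "r z = (if F z = 0 then k z ^ m / q z else p z / F z ^ m)" for z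
  have rA: "r z = k z ^ m / q z" if "z \<in> A" for z
    using that eq[of z] kF(5) by (auto simp: r_def A_def field_simps power_mult_distrib)
  have rB: "r z = p z / F z ^ m" if "z \<in> B" for z
    using that by (auto simp: r_def B_def)
  have "(\<lambda>z. k z ^ m / q z) holomorphic_on A"
    using kF(1) hol(2) by (intro holomorphic_intros) (auto simp: A_def intro: holomorphic_on_subset)
  then have "r holomorphic_on A"
    by (rule holomorphic_transform) (simp add: rA)
  moreover have "(\<lambda>z. p z / F z ^ m) holomorphic_on B"
    using kF(2) hol(1) by (intro holomorphic_intros) (auto simp: B_def intro: holomorphic_on_subset)
  then have "r holomorphic_on B"
    by (rule holomorphic_transform) (simp add: rB)
  ultimately have "r holomorphic_on (A \<union> B)"
    using openA openB by (rule holomorphic_on_Un)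
  moreover have "A \<union> B = UNIV"
    using F0 by (auto simp: B_def)
  ultimately have rhol: "r holomorphic_on UNIV" by simp
  have rnz: "r z \<noteq> 0" for z
  proof (cases "F z = 0")
    case True
    then show ?thesis using kF(4) by (auto simp: F0 rA A_def)
  next
    case False
    then show ?thesis using pF by (auto simp: r_def)
  qed
  obtain s where s: "s holomorphic_on UNIV" "\<And>z. exp (s z) = r z"
    by (rule holomorphic_logarithm_exists[OF convex_UNIV open_UNIV rhol rnz UNIV_I]) auto
  show ?thesis
  proof
    show "(\<lambda>z. F z * exp (s z / of_nat m)) holomorphic_on UNIV"
      using kF(2) s(1) by (intro holomorphic_intros) (use m in auto)
    show "(F z * exp (s z / of_nat m)) ^ m = p z" for z
    proof -
      have "exp (s z / of_nat m) ^ m = r z"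
        using m s(2)[of z] exp_of_nat_mult[of m "s z / of_nat m"] by simp
      then have "(F z * exp (s z / of_nat m)) ^ m = F z ^ m * r z"
        by (simp add: power_mult_distrib)
      also have "\<dots> = p z"
        using eq[of z] m by (auto simp: r_def F0 A_def power_0_left)
      finally show ?thesis .
    qed
  qed
qed

text \<open>The quotient \<open>P / Q\<close> is entire and omits \<open>0\<close> and
  \<open>v\<close>, so little Picard applies.\<close>

lemma entire_omits_two_values_ratio:
  fixes P Q :: "complex \<Rightarrow> complex"
  assumes "P holomorphic_on UNIV" "Q holomorphic_on UNIV"
    and "\<And>z. P z \<noteq> 0" "\<And>z. Q z \<noteq> 0" "\<And>z. P z \<noteq> v * Q z" "v \<noteq> 0"
  obtains c where "\<And>z. P z = c * Q z"
proof -
  have "(\<lambda>z. P z / Q z) holomorphic_on UNIV"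
    using assms by (intro holomorphic_intros) auto
  moreover have "range (\<lambda>z. P z / Q z) \<inter> {0, v} = {}"
  proof -
    have "P z / Q z \<noteq> 0" "P z / Q z \<noteq> v" for z
      using assms(3-5)[of z] by (auto simp: divide_eq_eq)
    then show ?thesis by fastforce
  qed
  ultimately obtain c where "(\<lambda>z. P z / Q z) = (\<lambda>z. c)"
    using \<open>v \<noteq> 0\<close> by (elim little_Picard) auto
  then have "P z / Q z = c" for z by (rule fun_cong)
  then show thesis
    using assms(4) that by (auto simp: field_simps)
qed

text \<open>The factors \<open>a - b\<close> and \<open>a - c\<close> have no zeros and never agree,
  so Picard makes them proportional. Eliminating \<open>a\<close> from the two factorizations leaves
  the square of \<open>a - c\<close> constant.\<close>

lemma entire_square_differences_const:
  fixes a b c :: "complex \<Rightarrow> complex"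
  assumes hol: "a holomorphic_on UNIV" "b holomorphic_on UNIV" "c holomorphic_on UNIV"
    and eq: "\<And>z. a z ^ 2 - b z ^ 2 = s" "\<And>z. a z ^ 2 - c z ^ 2 = t"
    and st: "s \<noteq> 0" "t \<noteq> 0" "s \<noteq> t"
  shows "a constant_on UNIV"
proof -
  define P where "P z = a z - b z" for z
  define Q where "Q z = a z - c z" for z
  \<comment> \<open>\<open>2 * a z - P z\<close> is the other factor \<open>a z + b z\<close>. In
    this form, \<open>P z = Q z\<close> would force \<open>s = t\<close>.\<close>
  have P: "P z * (2 * a z - P z) = s" and Q: "Q z * (2 * a z - Q z) = t" for z
    using eq[of z] by (auto simp: P_def Q_def power2_eq_square algebra_simps)
  have hP: "P holomorphic_on UNIV" and hQ: "Q holomorphic_on UNIV"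
    unfolding P_def Q_def by (intro holomorphic_intros hol)+
  have ne: "P z \<noteq> 0" "Q z \<noteq> 0" "P z \<noteq> 1 * Q z" for z
    using P[of z] Q[of z] st by auto
  obtain l where l: "\<And>z. P z = l * Q z"
    using entire_omits_two_values_ratio[OF hP hQ ne, of thesis] by auto
  have l1: "l \<noteq> 1" "l \<noteq> 0"
    using l ne by auto
  have "Q z ^ 2 = (s / l - t) / (1 - l)" for z
  proof -
    have "Q z * (2 * a z - l * Q z) = s / l"
      using P[of z] l l1 by (simp add: field_simps)
    then have "(1 - l) * Q z ^ 2 = s / l - t"
      using Q[of z] by (simp add: power2_eq_square algebra_simps)
    then show ?thesis
      using l1 by (simp add: field_simps)
  qed
  then have "Q constant_on UNIV"
    using entire_power_const_imp_const[OF hQ, of 2] by auto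
  then obtain d where d: "\<And>z. Q z = d"
    by (auto simp: constant_on_def)
  have "a z = (t / d + d) / 2" for z
    using Q[of z] ne(2)[of z] by (simp add: d field_simps)
  then show ?thesis unfolding constant_on_def by blast
qed

text \<open>Every factor \<open>a - u * b\<close> with \<open>u ^ m = 1\<close> is free of zeros.
  For \<open>m \<ge> 3\<close> there are three distinct roots \<open>1\<close>, \<open>w\<close>,
  \<open>w ^ 2\<close>, and the factor for \<open>w ^ 2\<close> is a linear combination of the other
  two, so the quotient of those two omits a second value besides \<open>0\<close>.\<close>

lemma entire_power_difference_const:
  fixes a b :: "complex \<Rightarrow> complex"
  assumes hol: "a holomorphic_on UNIV" "b holomorphic_on UNIV"
    and m: "m \<ge> 3" and eq: "\<And>z. a z ^ m - b z ^ m = s" and s: "s \<noteq> 0"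
  shows "a constant_on UNIV"
proof -
  define w where "w = cis (2 * pi / m)"
  have "w ^ m = cis (real m * (2 * pi / m))"
    by (simp only: w_def Complex.DeMoivre)
  then have wm: "w ^ m = 1"
    using m by simp
  have "0 < 2 * pi / m" "2 * pi / m < pi"
    using m by (auto simp: field_simps)
  \<comment> \<open>The angle lies strictly between \<open>0\<close> and \<open>pi\<close> because
    \<open>m \<ge> 3\<close>; hence \<open>w\<close> is not real, and \<open>1\<close>,
    \<open>w\<close>, \<open>w ^ 2\<close> are distinct.\<close>
  then have "sin (2 * pi / m) \<noteq> 0"
    using sin_gt_zero by fastforce
  then have "Im w \<noteq> 0"
    by (simp add: w_def)
  then have w: "w \<noteq> 1" "w \<noteq> 0" "1 + w \<noteq> 0"
    by (auto simp: complex_eq_iff)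
  have ne: "a z \<noteq> u * b z" if "u ^ m = 1" for u z
    using eq[of z] s that by (auto simp: power_mult_distrib)
  define P where "P z = a z - b z" for z
  define Q where "Q z = a z - w * b z" for z
  have hP: "P holomorphic_on UNIV" and hQ: "Q holomorphic_on UNIV"
    unfolding P_def Q_def by (intro holomorphic_intros hol)+
  \<comment> \<open>The constant is chosen so that equality would mean
    \<open>a z = w ^ 2 * b z\<close>.\<close>
  have ne3: "P z \<noteq> (1 + w) / w * Q z" for z
  proof
    assume "P z = (1 + w) / w * Q z"
    then have "w * (a z - b z) = (1 + w) * (a z - w * b z)"
      using w by (simp add: P_def Q_def field_simps)
    then have "a z = w ^ 2 * b z"
      by (simp add: algebra_simps power2_eq_square)
    moreover have "(w ^ 2) ^ m = 1"
      using wm by (metis mult.commute one_power2 power_mult)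
    ultimately show False using ne by blast
  qed
  have ne12: "P z \<noteq> 0" "Q z \<noteq> 0" for z
    using ne[of 1 z] ne[OF wm, of z] by (auto simp: P_def Q_def)
  have "(1 + w) / w \<noteq> 0"
    using w by simp
  from entire_omits_two_values_ratio[OF hP hQ ne12 ne3 this]
  obtain l where "\<And>z. P z = l * Q z" by blast
  then have PQ: "a z - b z = l * (a z - w * b z)" for z
    by (simp add: P_def Q_def)
  have l: "(1 - l) * a z = (1 - l * w) * b z" for z
    using PQ[of z] by algebra
  show ?thesis
  proof (cases "l = 1")
    case True
    then have "b z = 0" for z
      using l[of z] w by simp
    then have "a z ^ m = s" for z
      using eq[of z] m by (simp add: power_0_left)
    then show ?thesis
      using entire_power_const_imp_const[OF hol(1), of m] m by auto
  next
    case False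
    define k where "k = (1 - l * w) / (1 - l)"
    have k: "a z = k * b z" for z
      using l[of z] False by (simp add: k_def field_simps)
    have kb: "(k ^ m - 1) * b z ^ m = s" for z
      using eq[of z] by (simp add: k power_mult_distrib algebra_simps)
    moreover have "k ^ m - 1 \<noteq> 0"
      using kb[of 0] s by auto
    ultimately have "b z ^ m = s / (k ^ m - 1)" for z
      using kb[of z] by (simp add: field_simps)
    then have "b constant_on UNIV"
      using entire_power_const_imp_const[OF hol(2), of m] m by auto
    then show ?thesis
      by (auto simp: constant_on_def k)
  qed
qed

text \<open>Dividing \<open>1 - u * g\<close> by \<open>u\<close> gives all these
  \<open>m\<close>-th powers the same coefficient of \<open>g\<close>, so their differences are
  constant. For \<open>m = 2\<close> one difference is not enough (\<open>cosh\<close> and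
  \<open>sinh\<close>), and both roots \<open>w\<close> and \<open>w ^ 2\<close> are used; for
  \<open>m \<ge> 3\<close> the single root \<open>w\<close> suffices.\<close>

lemma entire_power_sum_eq_1_imp_const:
  fixes g h :: "complex \<Rightarrow> complex"
  assumes hol: "g holomorphic_on UNIV" "h holomorphic_on UNIV"
    and nm: "n \<ge> 3" "m \<ge> 2" and eq: "\<And>z. g z ^ n + h z ^ m = 1"
  shows "h constant_on UNIV"
proof (cases "\<exists>z0. h z0 \<noteq> 0")
  case False
  then show ?thesis by (auto simp: constant_on_def)
next
  case True
  then obtain z0 where z0: "h z0 \<noteq> 0" by blast
  have root: "\<exists>a. a holomorphic_on UNIV \<and> (\<forall>z. a z ^ m = 1 - u * g z)" if u: "u ^ n = 1" for u
  proof -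
    have hol1: "(\<lambda>z. 1 - u * g z) holomorphic_on UNIV"
      and hol2: "(\<lambda>z. \<Sum>k<n. (u * g z) ^ k) holomorphic_on UNIV"
      using hol by (auto intro!: holomorphic_intros)
    have fact: "(1 - u * g z) * (\<Sum>k<n. (u * g z) ^ k) = h z ^ m" for z
    proof -
      have "(1 - u * g z) * (\<Sum>k<n. (u * g z) ^ k) = 1 - (u * g z) ^ n"
        by (rule one_diff_power_eq [symmetric])
      also have "\<dots> = h z ^ m"
        using eq[of z] u by (simp add: power_mult_distrib algebra_simps)
      finally show ?thesis .
    qed
    \<comment> \<open>Where \<open>u * g z = 1\<close>, the cofactor equals \<open>n\<close>, which
      is not zero.\<close>
    have cop: "1 - u * g z \<noteq> 0 \<or> (\<Sum>k<n. (u * g z) ^ k) \<noteq> 0" for z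
      using nm by (cases "u * g z = 1") auto
    have "m \<ge> 1"
      using nm by simp
    from entire_coprime_factor_of_power[OF hol1 hol2 hol(2) this fact cop z0]
    show ?thesis by metis
  qed
  define w where "w = cis (2 * pi / n)"
  have "w ^ n = cis (real n * (2 * pi / n))"
    by (simp only: w_def Complex.DeMoivre)
  then have wn: "w ^ n = 1"
    using nm by simp
  have "0 < 2 * pi / n" "2 * pi / n < pi"
    using nm by (auto simp: field_simps)
  then have "sin (2 * pi / n) \<noteq> 0"
    using sin_gt_zero by fastforce
  then have "Im w \<noteq> 0"
    by (simp add: w_def)
  then have w: "w \<noteq> 1" "w \<noteq> 0" "w \<noteq> - 1"
    by auto
  then have w2: "w ^ 2 \<noteq> 1"
    by (simp add: power2_eq_1_iff)
  have w2n: "(w ^ 2) ^ n = 1"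
    using wn by (metis mult.commute one_power2 power_mult)
  obtain a where a: "a holomorphic_on UNIV" "\<And>z. a z ^ m = 1 - g z"
    using root[of 1] by auto
  have scaled: "\<exists>b. b holomorphic_on UNIV \<and> (\<forall>z. a z ^ m - b z ^ m = 1 - 1 / u)"
    if u: "u ^ n = 1" for u
  proof -
    obtain b where b: "b holomorphic_on UNIV" "\<And>z. b z ^ m = 1 - u * g z"
      using root[OF u] by auto
    have u0: "u \<noteq> 0" using u nm by (auto simp: power_0_left)
    \<comment> \<open>An \<open>m\<close>-th root of \<open>u\<close>, so that
      \<open>(b z / \<sigma>) ^ m = 1 / u - g z\<close>.\<close>
    define \<sigma> where "\<sigma> = exp (Ln u / of_nat m)"
    have \<sigma>: "\<sigma> ^ m = u" "\<sigma> \<noteq> 0"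
      using u0 nm exp_of_nat_mult[of m "Ln u / of_nat m"] by (auto simp: \<sigma>_def)
    have "(\<lambda>z. b z / \<sigma>) holomorphic_on UNIV"
      using b(1) \<sigma> by (intro holomorphic_intros) auto
    moreover have "a z ^ m - (b z / \<sigma>) ^ m = 1 - 1 / u" for z
      using u0 by (simp add: a b \<sigma> power_divide field_simps)
    ultimately show ?thesis by blast
  qed
  have "a constant_on UNIV"
  proof (cases "m = 2")
    case True
    obtain b where b: "b holomorphic_on UNIV" "\<And>z. a z ^ 2 - b z ^ 2 = 1 - 1 / w"
      using scaled[OF wn] True by blast
    obtain c where c: "c holomorphic_on UNIV" "\<And>z. a z ^ 2 - c z ^ 2 = 1 - 1 / w ^ 2"
      using scaled[OF w2n] True by blast
    have "1 - 1 / w \<noteq> 0" "1 - 1 / w ^ 2 \<noteq> 0" "1 - 1 / w \<noteq> 1 - 1 / w ^ 2"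
      using w w2 by (simp_all add: power2_eq_square)
    from entire_square_differences_const[OF a(1) b(1) c(1) b(2) c(2) this]
    show ?thesis .
  next
    case False
    then have m3: "m \<ge> 3" using nm by simp
    obtain b where b: "b holomorphic_on UNIV" "\<And>z. a z ^ m - b z ^ m = 1 - 1 / w"
      using scaled[OF wn] by blast
    have "1 - 1 / w \<noteq> 0"
      using w by simp
    from entire_power_difference_const[OF a(1) b(1) m3 b(2) this]
    show ?thesis .
  qed
  then obtain d where "\<And>z. a z = d"
    by (auto simp: constant_on_def)
  then have "g z = 1 - d ^ m" for z
    using a(2)[of z] by (simp add: algebra_simps)
  then have "h z ^ m = 1 - (1 - d ^ m) ^ n" for z
    using eq[of z] by (metis add_diff_cancel_left')
  then show ?thesis
    using entire_power_const_imp_const[OF hol(2), of m] nm by auto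
qed

section \<open>Functions holomorphic on complex lines\<close>

definition cscale :: "complex \<Rightarrow> complex \<times> complex \<Rightarrow> complex \<times> complex" where
  "cscale t v = (t * fst v, t * snd v)"

lemma cscale_0 [simp]: "cscale 0 v = 0" and cscale_1 [simp]: "cscale 1 v = v"
  by (auto simp: cscale_def prod_eq_iff)

lemma norm_cscale: "norm (cscale t v) = norm t * norm v"
  by (auto simp: cscale_def norm_prod_def norm_mult power_mult_distrib real_sqrt_mult
      simp flip: distrib_left)

lemma continuous_on_cscale [continuous_intros]:
  "continuous_on S f \<Longrightarrow> continuous_on S g \<Longrightarrow> continuous_on S (\<lambda>x. cscale (f x) (g x))"
  unfolding cscale_def by (intro continuous_intros)

text \<open>The form in which entireness is used. Both conditions survive locally uniform limits, so
  derivatives inherit them, and every statement reduces to one variable.\<close>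

definition line_holomorphic :: "(complex \<times> complex \<Rightarrow> complex) \<Rightarrow> bool" where
  "line_holomorphic f \<longleftrightarrow>
     continuous_on UNIV f \<and> (\<forall>p v. (\<lambda>t. f (p + cscale t v)) holomorphic_on UNIV)"

lemma line_holomorphicD:
  assumes "line_holomorphic f"
  shows "continuous_on A f" "(\<lambda>t. f (p + cscale t v)) holomorphic_on S"
  using assms unfolding line_holomorphic_def
  by (blast intro: continuous_on_subset holomorphic_on_subset)+

lemma entire2_imp_line_holomorphic:
  assumes "entire2 f"
  shows "line_holomorphic f"
  unfolding line_holomorphic_def
proof (intro conjI allI)
  show "continuous_on UNIV f"
    using assms unfolding entire2_def
    by (meson continuous_at_imp_continuous_on has_derivative_continuous)
  fix p v
  show "(\<lambda>t. f (p + cscale t v)) holomorphic_on UNIV"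
    unfolding holomorphic_on_open[OF open_UNIV]
  proof
    fix t
    obtain a b where ab: "(f has_derivative (\<lambda>(x, y). a * x + b * y)) (at (p + cscale t v))"
      using assms unfolding entire2_def by blast
    have "((\<lambda>t. p + cscale t v) has_derivative (\<lambda>t. cscale t v)) (at t)"
      unfolding cscale_def by (auto intro!: derivative_eq_intros)
    from has_derivative_compose[OF this ab]
    have "((\<lambda>t. f (p + cscale t v)) has_derivative (*) (a * fst v + b * snd v)) (at t)"
      by (rule has_derivative_eq_rhs) (simp add: cscale_def fun_eq_iff algebra_simps)
    then show "\<exists>d. ((\<lambda>t. f (p + cscale t v)) has_field_derivative d) (at t)"
      unfolding has_field_derivative_def by blast
  qed
qed

section \<open>Directional derivatives: Cauchy estimates and inheritance of holomorphy on
  lines\<close>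

definition directional_deriv ::
    "complex \<times> complex \<Rightarrow> (complex \<times> complex \<Rightarrow> complex) \<Rightarrow> complex \<times> complex \<Rightarrow> complex" where
  "directional_deriv v f p = deriv (\<lambda>t. f (p + cscale t v)) 0"

lemma partial1_eq_directional_deriv: "partial1 f = directional_deriv (1, 0) f"
  by (rule ext) (auto simp: partial1_def directional_deriv_def cscale_def
      deriv_shift_0' o_def split: prod.splits)

lemma partial2_eq_directional_deriv: "partial2 f = directional_deriv (0, 1) f"
  by (rule ext) (auto simp: partial2_def directional_deriv_def cscale_def
      deriv_shift_0' o_def split: prod.splits)

text \<open>Cauchy's inequality on the unit circle of the line through \<open>p\<close>. The bound
  \<open>B\<close> is not enlarged, so iterating it costs only one unit of radius per
  derivative.\<close>

lemma directional_deriv_bound: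
  assumes f: "line_holomorphic f" and v: "norm v \<le> 1"
    and B: "\<And>q. dist p q \<le> 1 \<Longrightarrow> norm (f q) \<le> B"
  shows "norm (directional_deriv v f p) \<le> B"
proof -
  have hol: "(\<lambda>t. f (p + cscale t v)) holomorphic_on S" for S
    using f by (rule line_holomorphicD)
  have "norm (f (p + cscale x v)) \<le> B" if "norm x = 1" for x
    using that v by (intro B) (simp add: dist_norm norm_cscale)
  then have "norm (deriv (\<lambda>t. f (p + cscale t v)) 0) \<le> B"
    using Cauchy_inequality[of "\<lambda>t. f (p + cscale t v)" 0 1 B 1]
      hol holomorphic_on_imp_continuous_on[OF hol]
    by simp
  then show ?thesis by (simp add: directional_deriv_def)
qed

text \<open>First-order Taylor expansion along the line, with the second derivative bounded by
  Cauchy's inequality. The bound does not depend on \<open>p\<close> otherwise than through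
  \<open>B\<close>, which gives uniform convergence on balls.\<close>

lemma difference_quotient_bound:
  assumes f: "line_holomorphic f" and B: "\<And>q. dist p q \<le> 2 * norm v \<Longrightarrow> norm (f q) \<le> B"
    and h: "norm h \<le> 1" "h \<noteq> 0"
  shows "norm ((f (p + cscale h v) - f p) / h - directional_deriv v f p) \<le> 2 * B * norm h"
proof -
  define g where "g = (\<lambda>t. f (p + cscale t v))"
  have hol: "g holomorphic_on S" for S
    unfolding g_def using f by (rule line_holomorphicD)
  have B2: "norm ((deriv ^^ 2) g x) \<le> 2 * B" if x: "x \<in> cball 0 1" for x
  proof -
    have "norm (g y) \<le> B" if "norm (x - y) = 1" for y
    proof -
      have "norm y \<le> 2"
        using x that norm_triangle_sub[of y x] by (simp add: norm_minus_commute)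
      then show ?thesis
        unfolding g_def by (intro B) (auto simp: norm_cscale dist_norm intro!: mult_right_mono)
    qed
    then show ?thesis
      using Cauchy_inequality[of g x 1 B 2] hol holomorphic_on_imp_continuous_on[OF hol]
      by (simp add: fact_numeral)
  qed
  \<comment> \<open>The remainder in \<open>complex_Taylor\<close> is divided by
    \<open>fact 1\<close> only, so the factor \<open>fact 2\<close> from Cauchy's inequality stays
    in the bound.\<close>
  have "norm ((deriv ^^ 0) g h - (\<Sum>i\<le>1. (deriv ^^ i) g 0 * (h - 0) ^ i / fact i))
      \<le> 2 * B * norm (h - 0) ^ Suc 1 / fact 1"
  proof (rule complex_Taylor[of "cball 0 1"])
    show "((deriv ^^ i) g has_field_derivative (deriv ^^ Suc i) g x) (at x within cball 0 1)" for i x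
      using holomorphic_higher_deriv[OF hol open_UNIV, of i]
      by (simp add: holomorphic_derivI has_field_derivative_at_within)
  qed (use B2 h in \<open>auto simp: numeral_2_eq_2\<close>)
  then have *: "norm (g h - g 0 - deriv g 0 * h) \<le> 2 * B * norm h ^ 2"
    by (simp add: power2_eq_square algebra_simps)
  have "(f (p + cscale h v) - f p) / h - directional_deriv v f p = (g h - g 0 - deriv g 0 * h) / h"
    using h by (simp add: g_def directional_deriv_def field_simps)
  also have "norm \<dots> \<le> 2 * B * norm h ^ 2 / norm h"
    unfolding norm_divide by (intro divide_right_mono *) simp
  also have "\<dots> = 2 * B * norm h"
    using h by (simp add: power2_eq_square)
  finally show ?thesis .
qed

lemma line_holomorphic_bounded_on_cball:
  assumes "line_holomorphic f"
  obtains B where "B \<ge> 0" "\<And>q. norm q \<le> R \<Longrightarrow> norm (f q) \<le> B"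
proof -
  have "compact (f ` cball 0 R)"
    using assms by (intro compact_continuous_image line_holomorphicD) auto
  then obtain B where B: "\<And>x. x \<in> f ` cball 0 R \<Longrightarrow> norm x \<le> B"
    using compact_imp_bounded bounded_iff by metis
  show thesis
  proof
    show "norm (f q) \<le> max 0 B" if "norm q \<le> R" for q
      using B[of "f q"] that by (simp add: le_max_iff_disj)
  qed simp
qed

text \<open>The difference quotients with step \<open>1 / (k + 1)\<close> are continuous and
  holomorphic on lines, and they converge to the derivative uniformly on balls.\<close>

lemma line_holomorphic_directional_deriv:
  assumes f: "line_holomorphic f"
  shows "line_holomorphic (directional_deriv v f)"
proof -
  define D where "D = directional_deriv v f"
  define F where "F k p = (f (p + cscale (1 / of_nat (Suc k)) v) - f p) / (1 / of_nat (Suc k))"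
    for k p
  have unif: "uniform_limit (cball 0 R) F D sequentially" for R
  proof -
    obtain B where B: "B \<ge> 0" "\<And>q. norm q \<le> R + 2 * norm v \<Longrightarrow> norm (f q) \<le> B"
      using line_holomorphic_bounded_on_cball[OF f] by metis
    have "norm (F k p - D p) \<le> 2 * B * (1 / Suc k)" if "p \<in> cball 0 R" for k p
    proof -
      have "norm (1 / of_nat (Suc k) :: complex) = 1 / Suc k"
        by (simp only: norm_divide norm_of_nat norm_one)
      moreover have "norm (f q) \<le> B" if "dist p q \<le> 2 * norm v" for q
        using that \<open>p \<in> cball 0 R\<close> norm_triangle_sub[of q p] 
        by (intro B(2)) (auto simp: dist_norm norm_minus_commute)
      ultimately show ?thesis
        unfolding F_def D_def
        using difference_quotient_bound[OF f, of p v B "1 / of_nat (Suc k)"]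
        by (simp del: of_nat_Suc)
    qed
    note bound = this
    have lim: "(\<lambda>k. 2 * B * (1 / Suc k)) \<longlonglongrightarrow> 2 * B * 0"
      by (intro tendsto_mult tendsto_const) (rule LIMSEQ_Suc[OF lim_1_over_n])
    show ?thesis
    proof (rule uniform_limitI)
      fix e :: real assume "e > 0"
      then have "\<forall>\<^sub>F k in sequentially. 2 * B * (1 / Suc k) < e"
        using order_tendstoD(2)[OF lim] by simp
      then show "\<forall>\<^sub>F k in sequentially. \<forall>p\<in>cball 0 R. dist (F k p) (D p) < e"
      proof eventually_elim
        case (elim k)
        show ?case
          using le_less_trans[OF bound elim] by (simp only: dist_norm) blast
      qed
    qed
  qed
  have "continuous_on (cball 0 R) D" for R
    by (rule uniform_limit_theorem[OF _ unif])
       (auto simp: F_def intro!: always_eventually continuous_intros continuous_on_compose2[OF line_holomorphicD(1)[OF f, of UNIV]])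
  then have "isCont D p" for p
    by (rule continuous_on_interior[of "cball 0 (norm p + 1)"]) (simp add: interior_cball)
  then have "continuous_on UNIV D"
    by (simp add: continuous_at_imp_continuous_on)
  moreover have "(\<lambda>t. D (p + cscale t w)) holomorphic_on UNIV" for p w
  proof (rule holomorphic_uniform_sequence[of _ "\<lambda>k t. F k (p + cscale t w)"])
    fix k
    have "(\<lambda>t. f (p + cscale (1 / of_nat (Suc k)) v + cscale t w)) holomorphic_on UNIV"
      "(\<lambda>t. f (p + cscale t w)) holomorphic_on UNIV"
      by (rule line_holomorphicD[OF f])+
    then show "(\<lambda>t. F k (p + cscale t w)) holomorphic_on UNIV"
      unfolding F_def by (intro holomorphic_intros) (simp_all add: add_ac)
  next
    fix x :: complex
    have "uniform_limit (cball x 1) (\<lambda>k t. F k (p + cscale t w)) (\<lambda>t. D (p + cscale t w)) sequentially"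
    proof (rule uniform_limit_compose'[OF unif[of "norm p + (norm x + 1) * norm w"]])
      show "(\<lambda>t. p + cscale t w) \<in> cball x 1 \<rightarrow> cball 0 (norm p + (norm x + 1) * norm w)"
      proof
        fix t assume "t \<in> cball x 1"
        then have "norm t \<le> norm x + 1"
          using norm_triangle_sub[of t x] by (simp add: dist_norm norm_minus_commute)
        then have "norm (cscale t w) \<le> (norm x + 1) * norm w"
          by (simp add: norm_cscale mult_right_mono)
        then show "p + cscale t w \<in> cball 0 (norm p + (norm x + 1) * norm w)"
          using norm_triangle_ineq[of p "cscale t w"] by simp
      qed
    qed
    then show "\<exists>d>0. cball x d \<subseteq> UNIV \<and>
        uniform_limit (cball x d) (\<lambda>k t. F k (p + cscale t w)) (\<lambda>t. D (p + cscale t w)) sequentially"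
      by (intro exI[of _ 1]) simp
  qed simp
  ultimately show ?thesis
    unfolding line_holomorphic_def D_def by blast
qed

lemma line_holomorphic_funpow:
  assumes "line_holomorphic f"
  shows "line_holomorphic ((directional_deriv v ^^ k) f)"
  using assms by (induction k) (auto intro: line_holomorphic_directional_deriv)

lemma line_holomorphic_partial_deriv:
  "line_holomorphic f \<Longrightarrow> line_holomorphic (partial_deriv I f)"
  unfolding partial_deriv_def partial1_eq_directional_deriv partial2_eq_directional_deriv
  by (intro line_holomorphic_funpow)

text \<open>The slack \<open>r\<close> and the moving point \<open>p'\<close> are there for the
  induction, which evaluates the lower derivative within distance 1 of \<open>p'\<close>.\<close>

lemma funpow_directional_deriv_bound:
  assumes "line_holomorphic f" "norm v \<le> 1" 
    and "\<And>q. dist p q \<le> real k + r \<Longrightarrow> norm (f q) \<le> B" "dist p p' \<le> r"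
  shows "norm ((directional_deriv v ^^ k) f p') \<le> B"
  using assms(3,4)
proof (induction k arbitrary: p' r)
  case 0
  then show ?case by simp
next
  case (Suc k)
  have "norm ((directional_deriv v ^^ k) f q) \<le> B" if "dist p' q \<le> 1" for q
  proof (rule Suc.IH[of "r + 1"])
    show "dist p q \<le> r + 1"
      using Suc.prems(2) that dist_triangle[of p q p'] by simp
  qed (use Suc.prems(1) in \<open>simp add: algebra_simps\<close>)
  then show ?case
    using directional_deriv_bound[OF line_holomorphic_funpow[OF assms(1)] assms(2)] by simp
qed

lemma partial_deriv_bound:
  assumes f: "line_holomorphic f"
    and B: "\<And>q. dist p q \<le> real (fst I + snd I) \<Longrightarrow> norm (f q) \<le> B"
  shows "norm (partial_deriv I f p) \<le> B"
  unfolding partial_deriv_def partial1_eq_directional_deriv partial2_eq_directional_deriv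
proof (rule funpow_directional_deriv_bound[of _ _ p _ 0])
  fix q assume q: "dist p q \<le> real (fst I) + 0"
  show "norm ((directional_deriv (0, 1) ^^ snd I) f q) \<le> B"
    \<comment> \<open>The slack is \<open>fst I\<close> because the outer derivatives have already
      moved \<open>q\<close> that far from \<open>p\<close>.\<close>
    by (rule funpow_directional_deriv_bound[OF f, of _ p _ "real (fst I)"])
       (use q B in \<open>auto simp: norm_Pair\<close>)
qed (auto simp: norm_Pair intro: line_holomorphic_funpow f)

section \<open>Subharmonicity of \<open>log\<^sup>+ |h|\<close>\<close>

text \<open>On the unit circle \<open>z * cnj z = 1\<close>, so each mixed monomial is a power of
  \<open>z\<close> or of \<open>cnj z\<close>, and real parts do not see the conjugation. The
  induction splits off the constant terms \<open>a\<close> and \<open>b\<close> and lowers both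
  degrees at once.\<close>

lemma Re_poly_mult_cnj_on_circle:
  fixes P Q :: "complex poly"
  shows "\<exists>R. \<forall>z. norm z = 1 \<longrightarrow> Re (poly P z * cnj (poly Q z)) = Re (poly R z)"
proof (induction P arbitrary: Q)
  case 0
  show ?case by (intro exI[of _ 0]) simp
next
  case (pCons a P)
  obtain b Q' where Q: "Q = pCons b Q'"
    by (cases Q)
  obtain R where R: "\<And>z. norm z = 1 \<Longrightarrow> Re (poly P z * cnj (poly Q' z)) = Re (poly R z)"
    using pCons.IH[of Q'] by blast
  define S where "S = smult (cnj a) Q + smult (cnj b) (pCons 0 P) + R"
  have "Re (poly (pCons a P) z * cnj (poly Q z)) = Re (poly S z)" if z: "norm z = 1" for z
  proof -
    have zz: "z * cnj z = 1"
      using z by (simp add: complex_norm_square [symmetric])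
    have "poly (pCons a P) z * cnj (poly Q z)
        = a * cnj (poly Q z) + cnj b * (z * poly P z) + (z * cnj z) * (poly P z * cnj (poly Q' z))"
      by (simp add: Q algebra_simps)
    moreover have "Re (a * cnj (poly Q z)) = Re (cnj a * poly Q z)"
      by simp
    ultimately show ?thesis
      using R[OF z] zz by (simp add: S_def algebra_simps)
  qed
  then show ?case by blast
qed

text \<open>Turns the approximants of Stone-Weierstrass into boundary values of real parts of
  holomorphic functions, to which the mean value property applies.\<close>

lemma real_polynomial_function_on_circle_eq_Re_poly:
  fixes g :: "complex \<Rightarrow> real"
  assumes "real_polynomial_function g"
  shows "\<exists>P :: complex poly. \<forall>z. norm z = 1 \<longrightarrow> g z = Re (poly P z)"
  using assms
proof induction
  case (linear g)
  interpret bounded_linear g by fact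
  have "g z = Re (poly [:0, Complex (g 1) (- g \<i>):] z)" for z
  proof -
    have "z = Re z *\<^sub>R 1 + Im z *\<^sub>R \<i>"
      by (simp add: complex_eq_iff)
    then have "g z = Re z * g 1 + Im z * g \<i>"
      by (metis add scaleR real_scaleR_def)
    then show ?thesis by simp
  qed
  then show ?case by blast
next
  case (const c)
  show ?case by (intro exI[of _ "[:of_real c:]"]) simp
next
  case (add f g)
  then obtain P Q where "\<forall>z. norm z = 1 \<longrightarrow> f z = Re (poly P z)"
    "\<forall>z. norm z = 1 \<longrightarrow> g z = Re (poly Q z)" by blast
  then show ?case by (intro exI[of _ "P + Q"]) simp
next
  case (mult f g)
  then obtain P Q where PQ: "\<And>z. norm z = 1 \<Longrightarrow> f z = Re (poly P z)"
    "\<And>z. norm z = 1 \<Longrightarrow> g z = Re (poly Q z)" by blast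
  obtain R where R: "\<And>z. norm z = 1 \<Longrightarrow> Re (poly P z * cnj (poly Q z)) = Re (poly R z)"
    using Re_poly_mult_cnj_on_circle[of P Q] by blast
  \<comment> \<open>Uses \<open>2 * Re p * Re q = Re (p * q) + Re (p * cnj q)\<close>.\<close>
  have "f z * g z = Re (poly (smult (1 / 2) (P * Q + R)) z)" if "norm z = 1" for z
    using PQ[OF that] R[OF that] by (simp add: field_simps)
  then show ?case by blast
qed

section \<open>Means over the unit circle\<close>

definition unit_circle_point :: "real \<Rightarrow> complex" where
  "unit_circle_point x = exp (2 * of_real pi * \<i> * of_real x)"

lemma norm_unit_circle_point [simp]: "norm (unit_circle_point x) = 1"
  by (simp add: unit_circle_point_def norm_exp_eq_Re)

lemma continuous_on_unit_circle_point [continuous_intros]: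
  "continuous_on S f \<Longrightarrow> continuous_on S (\<lambda>x. unit_circle_point (f x))"
  unfolding unit_circle_point_def by (intro continuous_intros)

lemma mean_value_unit_circle:
  assumes "P holomorphic_on UNIV"
  shows "((\<lambda>x. P (unit_circle_point x)) has_integral P 0) {0..1}"
proof -
  have "((\<lambda>u. P u / (u - 0)) has_contour_integral (2 * of_real pi * \<i>) * P 0) (circlepath 0 1)"
    by (rule Cauchy_integral_circlepath_simple) (auto intro: holomorphic_on_subset[OF assms])
  then have "((\<lambda>x. 2 * of_real pi * \<i> * P (unit_circle_point x)) has_integral
      2 * of_real pi * \<i> * P 0) {0..1}"
    unfolding has_contour_integral_def
    by (rule has_integral_eq[rotated])
       (simp add: vector_derivative_circlepath01, simp add: circlepath unit_circle_point_def)
  from has_integral_mult_right[OF this, of "1 / (2 * of_real pi * \<i>)"]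
  show ?thesis by simp
qed

lemma norm_le_exp_log_plus: "norm z \<le> exp (log_plus (norm z))"
  by (cases "z = 0") (auto simp: log_plus_def max_def)

lemma log_plus_nonneg: "0 \<le> log_plus x"
  by (simp add: log_plus_def)

lemma log_plus_le: "x \<le> exp y \<Longrightarrow> 0 \<le> x \<Longrightarrow> 0 \<le> y \<Longrightarrow> log_plus x \<le> y"
  unfolding log_plus_def using ln_le_cancel_iff[of x "exp y"] by (cases "x = 0") auto

lemma log_plus_eq_ln_max: "0 \<le> x \<Longrightarrow> log_plus x = ln (max 1 x)"
  by (cases "x = 0") (auto simp: log_plus_def max_def)

lemma continuous_on_log_plus [continuous_intros]:
  assumes "continuous_on S f" "\<And>x. x \<in> S \<Longrightarrow> 0 \<le> f x"
  shows "continuous_on S (\<lambda>x. log_plus (f x))"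
proof -
  have "continuous_on S (\<lambda>x. ln (max 1 (f x)))"
    by (intro continuous_intros assms) auto
  then show ?thesis
    by (rule continuous_on_eq) (simp add: assms log_plus_eq_ln_max)
qed

text \<open>
  The boundary values of \<open>log\<^sup>+ |h|\<close> are approximated uniformly by the real part of a polynomial
  \<open>P\<close>; the maximum principle for \<open>h exp (-P)\<close> replaces a discussion of the zeros of \<open>h\<close>.
\<close>

lemma log_plus_norm_le_circle_mean:
  assumes h: "h holomorphic_on UNIV"
  shows "log_plus (norm (h 0)) \<le> integral {0..1} (\<lambda>x. log_plus (norm (h (unit_circle_point x))))"
proof (rule field_le_epsilon)
  fix e :: real assume "e > 0"
  define v where "v z = log_plus (norm (h z))" for z
  have conth: "continuous_on S h" for S
    using holomorphic_on_imp_continuous_on[OF h] continuous_on_subset by blast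
  have contv: "continuous_on S v" for S
    unfolding v_def by (intro continuous_intros conth) simp
  obtain g where g: "real_polynomial_function g" "\<And>z. z \<in> sphere 0 1 \<Longrightarrow> \<bar>v z - g z\<bar> < e / 2"
    using Stone_Weierstrass_real_polynomial_function[of "sphere 0 1" v "e / 2"] contv \<open>e > 0\<close>
    by auto
  \<comment> \<open>The shift by \<open>e / 2\<close> puts \<open>Re P\<close> above
    \<open>v\<close> on the circle, at a cost of at most \<open>e\<close>.\<close>
  obtain P where P: "\<And>z. norm z = 1 \<Longrightarrow> g z + e / 2 = Re (poly P z)"
    using real_polynomial_function_on_circle_eq_Re_poly[OF
        real_polynomial_function.intros(3)[OF g(1) real_polynomial_function.intros(2)[of "e / 2"]]] by blast
  have le: "v z \<le> Re (poly P z)" "Re (poly P z) \<le> v z + e" if "norm z = 1" for z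
  proof -
    have "\<bar>v z - g z\<bar> < e / 2"
      using g(2)[of z] that by simp
    then show "v z \<le> Re (poly P z)" "Re (poly P z) \<le> v z + e"
      unfolding P[OF that, symmetric] by linarith+
  qed
  \<comment> \<open>Applied to \<open>k = h\<close> and to \<open>k = 1\<close>: the first bounds
    \<open>norm (h 0)\<close>, the second gives \<open>Re (poly P 0) \<ge> 0\<close>, and
    \<open>log_plus\<close> needs both.\<close>
  have maxmod: "norm (k 0 * exp (- poly P 0)) \<le> 1"
    if "k holomorphic_on UNIV" "\<And>z. norm z = 1 \<Longrightarrow> norm (k z) \<le> exp (v z)" for k
  proof (rule maximum_modulus_frontier[of "\<lambda>z. k z * exp (- poly P z)" "ball 0 1"])
    have "(\<lambda>z. k z * exp (- poly P z)) holomorphic_on UNIV"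
      by (intro holomorphic_intros that)
    then show "(\<lambda>z. k z * exp (- poly P z)) holomorphic_on interior (ball 0 1)"
      and "continuous_on (closure (ball 0 1)) (\<lambda>z. k z * exp (- poly P z))"
      by (meson holomorphic_on_imp_continuous_on holomorphic_on_subset subset_UNIV)+
    fix z :: complex assume "z \<in> frontier (ball 0 1)"
    then have z: "norm z = 1" by simp
    have "norm (k z) * exp (- Re (poly P z)) \<le> exp (v z) * exp (- Re (poly P z))"
      using that(2)[OF z] by (intro mult_right_mono) auto
    also have "\<dots> \<le> 1"
      using le(1)[OF z] by (simp flip: exp_add)
    finally show "norm (k z * exp (- poly P z)) \<le> 1"
      by (simp add: norm_mult norm_exp_eq_Re)
  qed auto
  have "norm (h 0) \<le> exp (Re (poly P 0))"
    using maxmod[OF h] by (simp add: v_def norm_le_exp_log_plus norm_divide exp_minus field_simps)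
  moreover have "0 \<le> Re (poly P 0)"
    using maxmod[of "\<lambda>_. 1"] by (simp add: v_def log_plus_nonneg norm_exp_eq_Re)
  ultimately have "v 0 \<le> Re (poly P 0)"
    unfolding v_def by (intro log_plus_le) auto
  also have "\<dots> = integral {0..1} (\<lambda>x. Re (poly P (unit_circle_point x)))"
    by (rule integral_unique[symmetric] has_integral_Re mean_value_unit_circle holomorphic_intros)+
  also have "\<dots> \<le> integral {0..1} (\<lambda>x. v (unit_circle_point x) + e)"
    by (intro integral_le integrable_continuous_real continuous_intros 
        continuous_on_compose2[OF contv[of UNIV]] le) auto
  also have "\<dots> = integral {0..1} (\<lambda>x. v (unit_circle_point x)) + e"
    by (subst integral_add) (auto intro!: integrable_continuous_real continuous_intros
        continuous_on_compose2[OF contv[of UNIV]])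
  finally show "log_plus (norm (h 0)) \<le> integral {0..1} (\<lambda>x. log_plus (norm (h (unit_circle_point x)))) + e"
    by (simp add: v_def)
qed

text \<open>Restated with the nonnegative integral, so that Tonelli can change the order of
  integration later with no integrability to check.\<close>

lemma log_plus_norm_le_circle_mean_nn:
  assumes h: "h holomorphic_on UNIV"
  shows "ennreal (log_plus (norm (h 0))) \<le>
    (\<integral>\<^sup>+x. ennreal (log_plus (norm (h (unit_circle_point x)))) * indicator {0..1} x \<partial>lborel)"
proof -
  have conth: "continuous_on UNIV h"
    by (rule holomorphic_on_imp_continuous_on[OF h])
  have c: "continuous_on {0..1} (\<lambda>x. log_plus (norm (h (unit_circle_point x))))"
    by (intro continuous_intros continuous_on_compose2[OF conth]) auto
  show ?thesis
  proof (cases "(\<integral>\<^sup>+x. ennreal (log_plus (norm (h (unit_circle_point x)))) * indicator {0..1} x \<partial>lborel) < \<infinity>")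
    case True
    then have "(\<integral>\<^sup>+x. ennreal (log_plus (norm (h (unit_circle_point x)))) * indicator {0..1} x \<partial>lborel)
        = ennreal (integral {0..1} (\<lambda>x. log_plus (norm (h (unit_circle_point x)))))"
      by (intro set_nn_integral_lborel_eq_integral)
         (use borel_integrable_compact[OF compact_Icc c] in
           \<open>auto simp: log_plus_nonneg set_borel_measurable_def\<close>)
    then show ?thesis
      using log_plus_norm_le_circle_mean[OF h] by (simp add: ennreal_leI)
  next
    case False
    then show ?thesis
      by (simp add: not_less top_unique)
  qed
qed

section \<open>Ball means and spherical means\<close>

lemma nn_integral_lborel_translation:
  fixes f :: "'a::euclidean_space \<Rightarrow> ennreal"
  assumes [measurable]: "f \<in> borel_measurable borel"
  shows "(\<integral>\<^sup>+x. f (a + x) \<partial>lborel) = (\<integral>\<^sup>+x. f x \<partial>lborel)"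
proof -
  have "(\<integral>\<^sup>+x. f x \<partial>lborel) = (\<integral>\<^sup>+x. f x \<partial>distr lborel borel ((+) a))"
    by (simp add: lborel_distr_plus)
  also have "\<dots> = (\<integral>\<^sup>+x. f (a + x) \<partial>lborel)"
    by (subst nn_integral_distr) auto
  finally show ?thesis by simp
qed

lemma nn_integral_lborel_scaleR:
  fixes f :: "'a::euclidean_space \<Rightarrow> ennreal"
  assumes [measurable]: "f \<in> borel_measurable borel" and c: "c \<noteq> 0"
  shows "(\<integral>\<^sup>+x. f x \<partial>lborel) = ennreal (\<bar>c\<bar> ^ DIM('a)) * (\<integral>\<^sup>+x. f (c *\<^sub>R x) \<partial>lborel)"
  by (subst lborel_affine[OF c, of 0])
     (simp add: nn_integral_density nn_integral_distr nn_integral_cmult ennreal_power)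

lemma nn_integral_lborel_swap:
  fixes f :: "'a::euclidean_space \<Rightarrow> 'b::euclidean_space \<Rightarrow> ennreal"
  assumes "(\<lambda>(x, y). f x y) \<in> borel_measurable borel"
  shows "(\<integral>\<^sup>+x. \<integral>\<^sup>+y. f x y \<partial>lborel \<partial>lborel) = (\<integral>\<^sup>+y. \<integral>\<^sup>+x. f x y \<partial>lborel \<partial>lborel)"
proof -
  have "(\<lambda>(x, y). f x y) \<in> borel_measurable (lborel \<Otimes>\<^sub>M lborel)"
    using assms by (simp add: lborel_prod)
  from lborel_pair.Fubini'[OF this] show ?thesis by simp
qed

lemma emeasure_lborel_ball_pos: "r > 0 \<Longrightarrow> emeasure lborel (ball (a :: 'a::euclidean_space) r) \<noteq> 0"
  using content_ball_pos[of r a]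
  by (simp add: measure_def zero_less_iff_neq_zero enn2real_positive_iff)

text \<open>
  The usual argument for the uniqueness of Haar measure: integrate \<open>B y * f (T x + y)\<close> in both
  orders, with \<open>B\<close> the indicator of the unit ball, whose invariance fixes the constant.
\<close>

lemma nn_integral_lborel_orthogonal:
  fixes f :: "'a::euclidean_space \<Rightarrow> ennreal" and T :: "'a \<Rightarrow> 'a"
  assumes T: "orthogonal_transformation T" and [measurable]: "f \<in> borel_measurable borel"
  shows "(\<integral>\<^sup>+x. f (T x) \<partial>lborel) = (\<integral>\<^sup>+x. f x \<partial>lborel)"
proof -
  define B :: "'a \<Rightarrow> ennreal" where "B = indicator (ball 0 1)"
  have [measurable]: "B \<in> borel_measurable borel"
    unfolding B_def by (intro borel_measurable_indicator borel_open open_ball)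
  have Bnorm: "B x = B y" if "norm x = norm y" for x y
    using that by (simp add: B_def indicator_def)
  define V where "V = (\<integral>\<^sup>+x. B x \<partial>lborel)"
  have V: "V \<noteq> 0" "V \<noteq> top"
    using emeasure_lborel_ball_pos[of 1 "0::'a"] emeasure_lborel_ball_finite[of "0::'a" 1]
    by (auto simp: V_def B_def less_top)
  have lin: "linear T" and nT: "\<And>x. norm (T x) = norm x"
    using T by (auto simp: orthogonal_transformation)
  have [measurable]: "T \<in> borel_measurable borel"
    by (intro borel_measurable_continuous_onI linear_continuous_on) (simp add: lin linear_conv_bounded_linear[symmetric])
  obtain T' where T': "\<And>y. T (T' y) = y"
    using orthogonal_transformation_surj[OF T] by (metis surjD)
  have "V * (\<integral>\<^sup>+x. f (T x) \<partial>lborel) = (\<integral>\<^sup>+y. B y * (\<integral>\<^sup>+x. f (T x) \<partial>lborel) \<partial>lborel)"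
    by (simp add: V_def nn_integral_multc)
  also have "\<dots> = (\<integral>\<^sup>+y. \<integral>\<^sup>+x. B y * f (T x + y) \<partial>lborel \<partial>lborel)"
  proof (rule nn_integral_cong)
    fix y :: 'a
    have "(\<integral>\<^sup>+x. f (T x) \<partial>lborel) = (\<integral>\<^sup>+x. f (T (T' y + x)) \<partial>lborel)"
      by (rule nn_integral_lborel_translation[symmetric]) measurable
    also have "\<dots> = (\<integral>\<^sup>+x. f (T x + y) \<partial>lborel)"
      by (simp add: linear_add[OF lin] T' add.commute)
    finally show "B y * (\<integral>\<^sup>+x. f (T x) \<partial>lborel) = (\<integral>\<^sup>+x. B y * f (T x + y) \<partial>lborel)"
      by (simp add: nn_integral_cmult)
  qed
  also have "\<dots> = (\<integral>\<^sup>+x. \<integral>\<^sup>+y. B y * f (T x + y) \<partial>lborel \<partial>lborel)"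
    by (rule nn_integral_lborel_swap) (simp add: borel_prod[symmetric])
  also have "\<dots> = (\<integral>\<^sup>+x. \<integral>\<^sup>+y. B (y - T x) * f y \<partial>lborel \<partial>lborel)"
  proof (rule nn_integral_cong)
    fix x :: 'a
    show "(\<integral>\<^sup>+y. B y * f (T x + y) \<partial>lborel) = (\<integral>\<^sup>+y. B (y - T x) * f y \<partial>lborel)"
      using nn_integral_lborel_translation[of "\<lambda>y. B (y - T x) * f y" "T x"] by simp
  qed
  also have "\<dots> = (\<integral>\<^sup>+y. \<integral>\<^sup>+x. B (y - T x) * f y \<partial>lborel \<partial>lborel)"
    by (rule nn_integral_lborel_swap) (simp add: borel_prod[symmetric])
  also have "\<dots> = (\<integral>\<^sup>+y. V * f y \<partial>lborel)"
  proof (rule nn_integral_cong)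
    fix y :: 'a
    \<comment> \<open>\<open>B\<close> depends only on the norm, which \<open>T\<close>
      preserves.\<close>
    have "(\<integral>\<^sup>+x. B (y - T x) \<partial>lborel) = (\<integral>\<^sup>+x. B (- T' y + x) \<partial>lborel)"
    proof (intro nn_integral_cong Bnorm)
      fix x
      have "y - T x = T (T' y - x)"
        by (simp add: linear_diff[OF lin] T')
      then show "norm (y - T x) = norm (- T' y + x)"
        by (simp add: nT norm_minus_commute)
    qed
    also have "\<dots> = V"
      unfolding V_def by (rule nn_integral_lborel_translation) measurable
    finally show "(\<integral>\<^sup>+x. B (y - T x) * f y \<partial>lborel) = V * f y"
      by (simp add: nn_integral_multc)
  qed
  also have "\<dots> = V * (\<integral>\<^sup>+y. f y \<partial>lborel)"
    by (simp add: nn_integral_cmult)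
  finally show ?thesis
    using V by (simp add: ennreal_mult_cancel_left)
qed

lemma orthogonal_transformation_cscale:
  "norm u = 1 \<Longrightarrow> orthogonal_transformation (cscale u)"
  unfolding orthogonal_transformation
  by (auto simp: norm_cscale intro!: linearI) (auto simp: cscale_def algebra_simps)

lemma log_plus_norm_measurable [measurable]:
  assumes "line_holomorphic f"
  shows "(\<lambda>p. log_plus (norm (f p))) \<in> borel_measurable borel"
  by (intro borel_measurable_continuous_onI continuous_intros line_holomorphicD[OF assms]) auto

text \<open>Apply the circle inequality on the line \<open>w + t z\<close> and integrate over
  \<open>z\<close> in the ball. After swapping the integrals, the rotation by
  \<open>unit_circle_point x\<close> preserves both the ball and Lebesgue measure, so the inner
  integral is the same for every \<open>x\<close>.\<close>

lemma log_plus_norm_le_ball_mean: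
  assumes f: "line_holomorphic f"
  defines "U \<equiv> \<lambda>p. ennreal (log_plus (norm (f p)))"
  shows "U w * emeasure lborel (ball (0 :: complex \<times> complex) \<rho>) \<le>
    (\<integral>\<^sup>+p. U p * indicator (ball w \<rho>) p \<partial>lborel)"
proof -
  have [measurable]: "U \<in> borel_measurable borel"
    unfolding U_def using log_plus_norm_measurable[OF f] by measurable
  define B :: "complex \<times> complex \<Rightarrow> ennreal" where "B = indicator (ball 0 \<rho>)"
  have [measurable]: "B \<in> borel_measurable borel"
    unfolding B_def by (intro borel_measurable_indicator borel_open open_ball)
  have m2: "(\<lambda>(x, z). cscale (unit_circle_point x) z) \<in> borel_measurable borel"
    by (intro borel_measurable_continuous_onI) (auto simp: case_prod_beta intro!: continuous_intros)
  have m1: "cscale u \<in> borel_measurable borel" for u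
    by (intro borel_measurable_continuous_onI continuous_intros)
  define I :: "real \<Rightarrow> ennreal" where "I = indicator {0..1}"
  have [measurable]: "I \<in> borel_measurable borel"
    unfolding I_def by measurable
  have "U w * emeasure lborel (ball (0 :: complex \<times> complex) \<rho>) = (\<integral>\<^sup>+z. U w * B z \<partial>lborel)"
    by (subst nn_integral_cmult) (auto simp: B_def intro!: borel_measurable_indicator)
  also have "\<dots> \<le> (\<integral>\<^sup>+z. \<integral>\<^sup>+x. I x * (B z * U (w + cscale (unit_circle_point x) z)) \<partial>lborel \<partial>lborel)"
  proof (rule nn_integral_mono)
    fix z :: "complex \<times> complex"
    have mz: "(\<lambda>x. U (w + cscale (unit_circle_point x) z)) \<in> borel_measurable borel"
      by (rule measurable_compose[of _ _ borel])
         (auto intro!: borel_measurable_continuous_onI continuous_intros)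
    have "U w \<le> (\<integral>\<^sup>+x. U (w + cscale (unit_circle_point x) z) * I x \<partial>lborel)"
      using log_plus_norm_le_circle_mean_nn[of "\<lambda>t. f (w + cscale t z)"] line_holomorphicD(2)[OF f]
      by (simp add: U_def I_def)
    then have "U w * B z \<le> (\<integral>\<^sup>+x. U (w + cscale (unit_circle_point x) z) * I x \<partial>lborel) * B z"
      by (rule mult_right_mono) simp
    also have "\<dots> = (\<integral>\<^sup>+x. (U (w + cscale (unit_circle_point x) z) * I x) * B z \<partial>lborel)"
      using mz by (intro nn_integral_multc[symmetric]) simp
    finally show "U w * B z \<le> (\<integral>\<^sup>+x. I x * (B z * U (w + cscale (unit_circle_point x) z)) \<partial>lborel)"
      by (simp add: mult_ac)
  qed
  also have "\<dots> = (\<integral>\<^sup>+x. \<integral>\<^sup>+z. I x * (B z * U (w + cscale (unit_circle_point x) z)) \<partial>lborel \<partial>lborel)"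
  proof (rule nn_integral_lborel_swap)
    have "(\<lambda>p. U (w + cscale (unit_circle_point (snd p)) (fst p))) \<in> borel_measurable borel"
      by (rule measurable_compose[of _ _ borel])
         (auto intro!: borel_measurable_continuous_onI continuous_intros)
    moreover have "(\<lambda>p. I (snd p) * B (fst p)) \<in> borel_measurable (borel :: ((complex \<times> complex) \<times> real) measure)"
      by (intro borel_measurable_times_ennreal
            measurable_compose[OF _ \<open>I \<in> borel_measurable borel\<close>]
            measurable_compose[OF _ \<open>B \<in> borel_measurable borel\<close>];
          intro borel_measurable_continuous_onI continuous_intros)
    ultimately have "(\<lambda>p. I (snd p) * B (fst p) * U (w + cscale (unit_circle_point (snd p)) (fst p))) \<in> borel_measurable borel"
      by (rule borel_measurable_times_ennreal[rotated])
    then show "(\<lambda>(z, x). I x * (B z * U (w + cscale (unit_circle_point x) z))) \<in> borel_measurable borel"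
      by (simp add: case_prod_beta mult_ac)
  qed
  also have "\<dots> = (\<integral>\<^sup>+x. I x * (\<integral>\<^sup>+z. B z * U (w + z) \<partial>lborel) \<partial>lborel)"
  proof (rule nn_integral_cong)
    fix x
    let ?T = "cscale (unit_circle_point x)"
    have "(\<integral>\<^sup>+z. B z * U (w + ?T z) \<partial>lborel) = (\<integral>\<^sup>+z. B (?T z) * U (w + ?T z) \<partial>lborel)"
      by (intro nn_integral_cong) (simp add: B_def indicator_def norm_cscale)
    also have "\<dots> = (\<integral>\<^sup>+z. B z * U (w + z) \<partial>lborel)"
      by (rule nn_integral_lborel_orthogonal[OF orthogonal_transformation_cscale]) auto
    finally show "(\<integral>\<^sup>+z. I x * (B z * U (w + ?T z)) \<partial>lborel) = I x * (\<integral>\<^sup>+z. B z * U (w + z) \<partial>lborel)"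
      using m1 by (subst nn_integral_cmult) auto
  qed
  also have "\<dots> = (\<integral>\<^sup>+z. B z * U (w + z) \<partial>lborel)"
    by (simp add: nn_integral_multc) (simp add: I_def)
  also have "\<dots> = (\<integral>\<^sup>+z. B (w + z - w) * U (w + z) \<partial>lborel)"
    by simp
  also have "\<dots> = (\<integral>\<^sup>+z. B (z - w) * U z \<partial>lborel)"
    by (rule nn_integral_lborel_translation) measurable
  also have "\<dots> = (\<integral>\<^sup>+p. U p * indicator (ball w \<rho>) p \<partial>lborel)"
    by (intro nn_integral_cong) (auto simp: B_def indicator_def dist_norm norm_minus_commute)
  finally show ?thesis .
qed

text \<open>
  Substitute \<open>s = t |z|\<close> in the inner integral and then \<open>w = t z\<close>; restricting to \<open>2 < t < 3\<close>
  bounds the Jacobian \<open>t\<^sup>-\<^sup>d\<close> and the factor \<open>|z|\<close> from below.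
\<close>

lemma nn_integral_annulus_le_spherical_means:
  fixes U :: "'a::euclidean_space \<Rightarrow> ennreal"
  assumes [measurable]: "U \<in> borel_measurable borel"
  shows "(\<integral>\<^sup>+w. U w * indicator {w. 1 \<le> norm w \<and> norm w \<le> 2} w \<partial>lborel) \<le>
    ennreal (3 ^ (DIM('a) + 1)) *
    (\<integral>\<^sup>+s. (\<integral>\<^sup>+z. U (s *\<^sub>R sgn z) * indicator (ball 0 1) z \<partial>lborel) * indicator {1..2} s \<partial>lborel)"
proof -
  define H where "H w = U w * indicator {w. 1 \<le> norm w \<and> norm w \<le> 2} w" for w
  have [measurable]: "H \<in> borel_measurable borel"
    unfolding H_def by measurable
  define J :: "real \<Rightarrow> ennreal" where "J = indicator {2<..<3}"
  define I :: "real \<Rightarrow> ennreal" where "I = indicator {1..2}"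
  define B :: "'a \<Rightarrow> ennreal" where "B = indicator (ball 0 1)"
  have [measurable]: "J \<in> borel_measurable borel" "I \<in> borel_measurable borel"
      "B \<in> borel_measurable borel"
    unfolding J_def I_def B_def by (auto intro!: borel_measurable_indicator borel_open)
  have sgn_meas[measurable]: "sgn \<in> borel_measurable (borel :: 'a measure)"
    unfolding sgn_div_norm by measurable
  define D where "D = DIM('a)"
  \<comment> \<open>\<open>J\<close> is the indicator of an interval of length 1, so it can be
    inserted freely.\<close>
  have "(\<integral>\<^sup>+w. H w \<partial>lborel) = (\<integral>\<^sup>+t. J t * (\<integral>\<^sup>+w. H w \<partial>lborel) \<partial>lborel)"
    by (simp add: nn_integral_multc) (simp add: J_def)
  also have "\<dots> \<le> (\<integral>\<^sup>+t. ennreal (3 ^ D) * (\<integral>\<^sup>+z. J t * H (t *\<^sub>R z) \<partial>lborel) \<partial>lborel)"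
  proof (rule nn_integral_mono)
    fix t :: real
    show "J t * (\<integral>\<^sup>+w. H w \<partial>lborel) \<le> ennreal (3 ^ D) * (\<integral>\<^sup>+z. J t * H (t *\<^sub>R z) \<partial>lborel)"
    proof (cases "t \<in> {2<..<3}")
      case True
      then have "(\<integral>\<^sup>+w. H w \<partial>lborel) = ennreal (\<bar>t\<bar> ^ D) * (\<integral>\<^sup>+z. H (t *\<^sub>R z) \<partial>lborel)"
        unfolding D_def by (intro nn_integral_lborel_scaleR) auto
      also have "\<dots> \<le> ennreal (3 ^ D) * (\<integral>\<^sup>+z. H (t *\<^sub>R z) \<partial>lborel)"
        using True by (intro mult_right_mono ennreal_leI power_mono) auto
      finally show ?thesis
        using True by (simp add: J_def)
    qed (simp add: J_def)
  qed
  also have "\<dots> = ennreal (3 ^ D) * (\<integral>\<^sup>+t. \<integral>\<^sup>+z. J t * H (t *\<^sub>R z) \<partial>lborel \<partial>lborel)"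
    by (rule nn_integral_cmult) measurable
  finally have outer: "(\<integral>\<^sup>+w. H w \<partial>lborel)
      \<le> ennreal (3 ^ D) * (\<integral>\<^sup>+t. \<integral>\<^sup>+z. J t * H (t *\<^sub>R z) \<partial>lborel \<partial>lborel)" .
  have "(\<integral>\<^sup>+t. \<integral>\<^sup>+z. J t * H (t *\<^sub>R z) \<partial>lborel \<partial>lborel)
      = (\<integral>\<^sup>+z. \<integral>\<^sup>+t. J t * H (t *\<^sub>R z) \<partial>lborel \<partial>lborel)"
    by (rule nn_integral_lborel_swap) (simp add: borel_prod[symmetric])
  also have "\<dots> \<le> (\<integral>\<^sup>+z. 3 * (\<integral>\<^sup>+s. I s * (U (s *\<^sub>R sgn z) * B z) \<partial>lborel) \<partial>lborel)"
  proof (rule nn_integral_mono)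
    fix z :: 'a
    show "(\<integral>\<^sup>+t. J t * H (t *\<^sub>R z) \<partial>lborel) \<le> 3 * (\<integral>\<^sup>+s. I s * (U (s *\<^sub>R sgn z) * B z) \<partial>lborel)"
    proof (cases "z = 0")
      case True
      then show ?thesis by (simp add: H_def)
    next
      case False
      have "(\<integral>\<^sup>+t. J t * H (t *\<^sub>R z) \<partial>lborel)
          \<le> (\<integral>\<^sup>+t. ennreal (3 * norm z) * (I (norm z * t) * (U ((norm z * t) *\<^sub>R sgn z) * B z)) \<partial>lborel)"
      proof (rule nn_integral_mono)
        fix t :: real
        show "J t * H (t *\<^sub>R z) \<le> ennreal (3 * norm z) * (I (norm z * t) * (U ((norm z * t) *\<^sub>R sgn z) * B z))"
        proof (cases "2 < t \<and> t < 3 \<and> 1 \<le> norm z * t \<and> norm z * t \<le> 2")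
          case True
          \<comment> \<open>From \<open>t > 2\<close> and \<open>norm z * t \<le> 2\<close>; hence
            \<open>B z = 1\<close>.\<close>
          then have "norm z < 1"
            by (smt (verit, best) mult_le_cancel_right1 mult.commute)
          moreover have "1 \<le> 3 * norm z"
            using True mult_left_mono[of t 3 "norm z"] by simp
          then have "1 * U (t *\<^sub>R z) \<le> ennreal (3 * norm z) * U (t *\<^sub>R z)"
            by (intro mult_right_mono) (simp_all add: ennreal_1[symmetric] ennreal_leI del: ennreal_1)
          moreover have "(norm z * t) *\<^sub>R sgn z = t *\<^sub>R z"
            using False by (simp add: sgn_div_norm)
          ultimately show ?thesis
            using True by (simp add: J_def H_def I_def B_def abs_mult mult.commute)
        next
          case False
          then have "J t * H (t *\<^sub>R z) = 0"
            by (auto simp: J_def H_def indicator_def mult.commute)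
          then show ?thesis by (simp only: zero_le)
        qed
      qed
      also have "\<dots> = ennreal (3 * norm z) * (\<integral>\<^sup>+t. I (norm z * t) * (U ((norm z * t) *\<^sub>R sgn z) * B z) \<partial>lborel)"
        by (rule nn_integral_cmult) measurable
      also have "\<dots> = 3 * (norm z * (\<integral>\<^sup>+t. I (norm z * t) * (U ((norm z * t) *\<^sub>R sgn z) * B z) \<partial>lborel))"
        by (simp add: ennreal_mult mult.assoc)
      also have "norm z * (\<integral>\<^sup>+t. I (norm z * t) * (U ((norm z * t) *\<^sub>R sgn z) * B z) \<partial>lborel)
          = (\<integral>\<^sup>+s. I s * (U (s *\<^sub>R sgn z) * B z) \<partial>lborel)"
        using nn_integral_real_affine[of "\<lambda>s. I s * (U (s *\<^sub>R sgn z) * B z)" "norm z" 0] False by simp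
      finally show ?thesis .
    qed
  qed
  also have "\<dots> = 3 * (\<integral>\<^sup>+z. \<integral>\<^sup>+s. I s * (U (s *\<^sub>R sgn z) * B z) \<partial>lborel \<partial>lborel)"
    by (rule nn_integral_cmult) measurable
  also have "\<dots> = 3 * (\<integral>\<^sup>+s. \<integral>\<^sup>+z. I s * (U (s *\<^sub>R sgn z) * B z) \<partial>lborel \<partial>lborel)"
    by (rule arg_cong, rule nn_integral_lborel_swap) (simp add: borel_prod[symmetric])
  also have "\<dots> = 3 * (\<integral>\<^sup>+s. (\<integral>\<^sup>+z. U (s *\<^sub>R sgn z) * B z \<partial>lborel) * I s \<partial>lborel)"
    by (intro arg_cong[of _ _ "(*) 3"] nn_integral_cong) (simp add: nn_integral_cmult mult.commute)
  finally have inner: "(\<integral>\<^sup>+t. \<integral>\<^sup>+z. J t * H (t *\<^sub>R z) \<partial>lborel \<partial>lborel)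
      \<le> 3 * (\<integral>\<^sup>+s. (\<integral>\<^sup>+z. U (s *\<^sub>R sgn z) * B z \<partial>lborel) * I s \<partial>lborel)" .
  from order_trans[OF outer mult_left_mono[OF this zero_le]] show ?thesis
    by (simp add: H_def I_def B_def D_def ennreal_mult mult_ac)
qed

section \<open>Growth\<close>

text \<open>The sphere measure is the image of the uniform measure on the ball under
  \<open>sgn\<close>, so the characteristic is a ball average of a radially constant
  function.\<close>

lemma ball_integral_radial_eq_nevanlinna_T:
  assumes f: "line_holomorphic f"
  shows "(\<integral>\<^sup>+z. ennreal (log_plus (norm (f (r *\<^sub>R sgn z)))) * indicator (ball 0 1) z \<partial>lborel)
    = emeasure lborel (ball (0 :: complex \<times> complex) 1) * ennreal (nevanlinna_T r f)"
proof -
  let ?B = "ball 0 1 :: (complex \<times> complex) set"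
  define M where "M = uniform_measure lborel ?B"
  define g where "g z = log_plus (norm (f (r *\<^sub>R sgn z)))" for z
  have V: "emeasure lborel ?B \<noteq> 0" "emeasure lborel ?B \<noteq> \<infinity>"
    using emeasure_lborel_ball_pos[of 1 "0 :: complex \<times> complex"]
      emeasure_lborel_ball_finite[of "0 :: complex \<times> complex" 1] by auto
  interpret finite_measure M
    by (rule finite_measureI) (use V in \<open>simp add: M_def emeasure_uniform_measure ennreal_divide_self less_top\<close>)
  have sgn_meas [measurable]: "sgn \<in> borel_measurable (borel :: (complex \<times> complex) measure)"
    unfolding sgn_div_norm by measurable
  have [measurable]: "(\<lambda>p. log_plus (norm (f p))) \<in> borel_measurable borel"
    using f by (rule log_plus_norm_measurable)
  have [measurable]: "g \<in> borel_measurable borel"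
    unfolding g_def by measurable
  have [measurable_cong]: "sets M = sets borel"
    by (simp add: M_def)
  obtain C where C: "C \<ge> 0" "\<And>q. norm q \<le> \<bar>r\<bar> \<Longrightarrow> norm (f q) \<le> C"
    using line_holomorphic_bounded_on_cball[OF f] by metis
  have "norm (g z) \<le> C" for z
  proof -
    have "norm (r *\<^sub>R sgn z) \<le> \<bar>r\<bar>"
      by (simp add: norm_sgn)
    then have "norm (f (r *\<^sub>R sgn z)) \<le> exp C"
      using C(2) exp_ge_add_one_self[of C] by (smt (verit))
    then have "g z \<le> C"
      unfolding g_def using C(1) by (intro log_plus_le) auto
    then show ?thesis
      by (simp add: g_def log_plus_nonneg)
  qed
  \<comment> \<open>Without integrability the Bochner integral in \<open>nevanlinna_T\<close> would
    take its default value 0 and bound nothing.\<close>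
  then have int: "integrable M g"
    by (intro integrable_const_bound[of _ C]) auto
  have "nevanlinna_T r f = (\<integral>z. g z \<partial>M)"
    unfolding nevanlinna_T_def unit_sphere_measure_def M_def g_def sgn_div_norm
    by (rule integral_distr) measurable
  moreover have "(\<integral>\<^sup>+z. g z \<partial>M) = ennreal (\<integral>z. g z \<partial>M)"
    by (rule nn_integral_eq_integral[OF int]) (simp add: g_def log_plus_nonneg)
  ultimately have "ennreal (nevanlinna_T r f) = (\<integral>\<^sup>+z. g z \<partial>M)"
    by simp
  also have "\<dots> = (\<integral>\<^sup>+z. ennreal (g z) * indicator ?B z \<partial>lborel) / emeasure lborel ?B"
    unfolding M_def by (rule nn_integral_uniform_measure) auto
  finally show ?thesis
    unfolding g_def[symmetric]
    by (simp only: ennreal_times_divide mult.commute[of "emeasure lborel ?B"]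
        ennreal_mult_divide_eq V simp_thms infinity_ennreal_def [symmetric])
qed

lemma finite_order_bound:
  assumes "finite_order f"
  obtains K :: nat and r0 where "r0 \<ge> 1" "\<And>r. r \<ge> r0 \<Longrightarrow> nevanlinna_T r f \<le> r ^ K"
proof -
  obtain c where c: "Limsup at_top (\<lambda>r. ereal (log_plus (nevanlinna_T r f) / ln r)) < ereal c"
    using assms less_PInf_Ex_of_nat[of "Limsup at_top (\<lambda>r. ereal (log_plus (nevanlinna_T r f) / ln r))"] 
    unfolding finite_order_def by auto
  define K where "K = nat \<lceil>c\<rceil>"
  have "\<forall>\<^sub>F r in at_top. log_plus (nevanlinna_T r f) / ln r < c"
    using Limsup_lessD[OF c] by simp
  then obtain r1 where r1: "\<And>r. r \<ge> r1 \<Longrightarrow> log_plus (nevanlinna_T r f) / ln r < c"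
    unfolding eventually_at_top_linorder by blast
  show thesis
  proof
    show "max r1 2 \<ge> 1" by simp
    fix r assume r: "r \<ge> max r1 2"
    then have "ln r > 0" by simp
    then have "log_plus (nevanlinna_T r f) < c * ln r"
      using r1[of r] r by (simp add: pos_divide_less_eq)
    also have "\<dots> \<le> K * ln r"
      using \<open>ln r > 0\<close> by (intro mult_right_mono) (auto simp: K_def real_nat_ceiling_ge)
    also have "\<dots> = ln (r ^ K)"
      using r by (simp add: ln_realpow)
    finally have "ln (nevanlinna_T r f) < ln (r ^ K)"
      by (simp add: log_plus_def)
    \<comment> \<open>The logarithms are compared only for positive \<open>nevanlinna_T r f\<close>;
      otherwise \<open>r ^ K\<close> is larger trivially.\<close>
    then show "nevanlinna_T r f \<le> r ^ K"
      using r by (cases "nevanlinna_T r f > 0") (auto intro: order_trans[of _ 0])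
  qed
qed

lemma line_holomorphic_scaleR:
  assumes "line_holomorphic f"
  shows "line_holomorphic (\<lambda>z. f (R *\<^sub>R z))"
  unfolding line_holomorphic_def
proof (intro conjI allI)
  show "continuous_on UNIV (\<lambda>z. f (R *\<^sub>R z))"
    by (intro continuous_on_compose2[OF line_holomorphicD(1)[OF assms, of UNIV]] continuous_intros) auto
  show "(\<lambda>t. f (R *\<^sub>R (p + cscale t v))) holomorphic_on UNIV" for p v
    using line_holomorphicD(2)[OF assms, of "R *\<^sub>R p" "R *\<^sub>R v"]
    by (simp add: cscale_def scaleR_add_right)
qed

text \<open>Rescaling puts \<open>w\<close> at norm \<open>3 / 2\<close>, where the ball of radius
  \<open>1 / 2\<close> lies in the annulus between radii 1 and 2. The ball mean bounds
  \<open>log_plus (norm (f w))\<close> by the annulus integral, and this is bounded by the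
  characteristic at radii between \<open>R\<close> and \<open>2 * R\<close>. Small \<open>w\<close>
  are handled by compactness.\<close>

lemma finite_order_growth:
  assumes f: "line_holomorphic f" and ord: "finite_order f"
  obtains C :: real and K :: nat where "C \<ge> 0" "\<And>w. log_plus (norm (f w)) \<le> C * (1 + norm w) ^ K"
proof -
  obtain K :: nat and r0 where r0: "r0 \<ge> 1" "\<And>r. r \<ge> r0 \<Longrightarrow> nevanlinna_T r f \<le> r ^ K"
    using finite_order_bound[OF ord] by blast
  define V1 where "V1 = measure lborel (ball (0 :: complex \<times> complex) 1)"
  define V2 where "V2 = measure lborel (ball (0 :: complex \<times> complex) (1/2))"
  have V: "V1 > 0" "V2 > 0"
    unfolding V1_def V2_def by (auto intro!: content_ball_pos)
  have emV: "emeasure lborel (ball (0 :: complex \<times> complex) 1) = ennreal V1"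
      "emeasure lborel (ball (0 :: complex \<times> complex) (1/2)) = ennreal V2"
    unfolding V1_def V2_def by (intro emeasure_eq_ennreal_measure less_imp_neq[OF emeasure_lborel_ball_finite, unfolded infinity_ennreal_def])+
  \<comment> \<open>The exponent 5 is the real dimension 4 plus 1, from the annulus
    estimate.\<close>
  define C1 where "C1 = 3 ^ 5 * V1 / V2"
  have C1: "C1 \<ge> 0"
    using V by (simp add: C1_def)
  have large: "log_plus (norm (f w)) \<le> C1 * (2 * norm w) ^ K" if w: "norm w \<ge> 3 / 2 * r0" for w
  proof -
    define R where "R = 2 / 3 * norm w"
    have R: "R \<ge> r0" "R > 0"
      using w r0(1) by (auto simp: R_def)
    define w' where "w' = w /\<^sub>R R"
    have w': "norm w' = 3 / 2" "R *\<^sub>R w' = w"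
      using R by (auto simp: w'_def R_def)
    define U where "U p = ennreal (log_plus (norm (f (R *\<^sub>R p))))" for p
    note fR = line_holomorphic_scaleR[OF f, of R]
    have [measurable]: "U \<in> borel_measurable borel"
      unfolding U_def using log_plus_norm_measurable[OF fR] by measurable
    have "U w' * ennreal V2 \<le> (\<integral>\<^sup>+p. U p * indicator (ball w' (1/2)) p \<partial>lborel)"
      using log_plus_norm_le_ball_mean[OF fR, of w' "1/2"] unfolding U_def emV .
    also have "\<dots> \<le> (\<integral>\<^sup>+p. U p * indicator {p. 1 \<le> norm p \<and> norm p \<le> 2} p \<partial>lborel)"
    proof -
      have "ball w' (1/2) \<subseteq> {p. 1 \<le> norm p \<and> norm p \<le> 2}"
      proof
        fix p assume "p \<in> ball w' (1/2)"
        then have "norm (w' - p) < 1/2" by (simp add: dist_norm)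
        then have "1 \<le> norm p" "norm p \<le> 2"
          using w'(1) norm_triangle_ineq2[of w' p] norm_triangle_ineq2[of p w']
          by (simp_all add: norm_minus_commute)
        then show "p \<in> {p. 1 \<le> norm p \<and> norm p \<le> 2}" by simp
      qed
      then show ?thesis
        by (intro nn_integral_mono mult_left_mono) (auto split: split_indicator)
    qed
    also have "\<dots> \<le> ennreal (3 ^ 5) *
        (\<integral>\<^sup>+s. (\<integral>\<^sup>+z. U (s *\<^sub>R sgn z) * indicator (ball 0 1) z \<partial>lborel) * indicator {1..2} s \<partial>lborel)"
      using nn_integral_annulus_le_spherical_means[of U] by simp
    also have "\<dots> \<le> ennreal (3 ^ 5) * (\<integral>\<^sup>+s. ennreal (V1 * (2 * R) ^ K) * indicator {1..2::real} s \<partial>lborel)"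
    proof (intro mult_left_mono nn_integral_mono)
      fix s :: real
      show "(\<integral>\<^sup>+z. U (s *\<^sub>R sgn z) * indicator (ball 0 1) z \<partial>lborel) * indicator {1..2} s
          \<le> ennreal (V1 * (2 * R) ^ K) * indicator {1..2} s"
      proof (cases "s \<in> {1..2}")
        case True
        then have Rs: "R * 1 \<le> R * s" "R * s \<le> R * 2"
          using R by (intro mult_left_mono; simp)+
        have "(\<integral>\<^sup>+z. U (s *\<^sub>R sgn z) * indicator (ball 0 1) z \<partial>lborel) = ennreal V1 * ennreal (nevanlinna_T (R * s) f)"
          using ball_integral_radial_eq_nevanlinna_T[OF f, of "R * s"] unfolding emV by (simp add: U_def)
        also have "\<dots> \<le> ennreal V1 * ennreal ((2 * R) ^ K)"
        proof (intro mult_left_mono ennreal_leI)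
          have "nevanlinna_T (R * s) f \<le> (R * s) ^ K"
            using Rs R by (intro r0) linarith
          also have "\<dots> \<le> (2 * R) ^ K"
            using Rs R by (intro power_mono) auto
          finally show "nevanlinna_T (R * s) f \<le> (2 * R) ^ K" .
        qed simp
        finally show ?thesis
          using True V R by (simp add: ennreal_mult)
      qed simp
    qed simp_all
    also have "\<dots> = ennreal (3 ^ 5 * (V1 * (2 * R) ^ K))"
      using V R by (simp add: nn_integral_cmult ennreal_mult)
    finally have "ennreal (log_plus (norm (f w)) * V2) \<le> ennreal (3 ^ 5 * (V1 * (2 * R) ^ K))"
      using V by (simp add: U_def w' ennreal_mult log_plus_nonneg)
    then have "log_plus (norm (f w)) * V2 \<le> 3 ^ 5 * (V1 * (2 * R) ^ K)"
      using V R by (subst (asm) ennreal_le_iff) auto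
    then have "log_plus (norm (f w)) \<le> C1 * (2 * R) ^ K"
      using V by (simp add: C1_def field_simps)
    also have "\<dots> \<le> C1 * (2 * norm w) ^ K"
      using C1 R by (intro mult_left_mono power_mono) (auto simp: R_def)
    finally show ?thesis .
  qed
  obtain B where B: "B \<ge> 0" "\<And>q. norm q \<le> 3 / 2 * r0 \<Longrightarrow> norm (f q) \<le> B"
    using line_holomorphic_bounded_on_cball[OF f] by metis
  define C where "C = C1 * 2 ^ K + B"
  show thesis
  proof
    show "C \<ge> 0"
      using C1 B by (simp add: C_def)
    fix w
    show "log_plus (norm (f w)) \<le> C * (1 + norm w) ^ K"
    proof (cases "norm w \<ge> 3 / 2 * r0")
      case True
      have "log_plus (norm (f w)) \<le> C1 * 2 ^ K * norm w ^ K"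
        using large[OF True] by (simp add: power_mult_distrib mult.assoc)
      also have "\<dots> \<le> C * (1 + norm w) ^ K"
        using C1 B by (intro mult_mono power_mono) (auto simp: C_def)
      finally show ?thesis .
    next
      case False
      then have "norm (f w) \<le> exp B"
        using B(2)[of w] exp_ge_add_one_self[of B] by linarith
      then have "log_plus (norm (f w)) \<le> B"
        using B(1) by (intro log_plus_le) auto
      also have "B \<le> C * 1"
        using C1 by (simp add: C_def)
      also have "\<dots> \<le> C * (1 + norm w) ^ K"
        using C1 B by (intro mult_left_mono one_le_power) (auto simp: C_def)
      finally show ?thesis .
    qed
  qed
qed


section \<open>Non-constant functions and geometric growth of \<open>ln (norm (f z))\<close> along
  points\<close>

lemma nonconstant_on_line:
  assumes "f p \<noteq> f q"
  obtains v where "\<not> (\<lambda>t. f (p + cscale t v)) constant_on UNIV"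
proof
  show "\<not> (\<lambda>t. f (p + cscale t (q - p))) constant_on UNIV"
  proof
    assume "(\<lambda>t. f (p + cscale t (q - p))) constant_on UNIV"
    then obtain c where c: "\<And>t. f (p + cscale t (q - p)) = c"
      by (auto simp: constant_on_def)
    from c[of 0] c[of 1] show False
      using assms by simp
  qed
qed

lemma nonconstant_unbounded:
  assumes f: "line_holomorphic f" and "f p \<noteq> f q"
  obtains w where "norm (f w) > A"
proof -
  obtain v where v: "\<not> (\<lambda>t. f (p + cscale t v)) constant_on UNIV"
    using nonconstant_on_line[of f p q] assms(2) by blast
  then have "\<not> bounded (range (\<lambda>t. f (p + cscale t v)))"
    using Liouville_theorem[OF line_holomorphicD(2)[OF f]] by blast
  then have "\<not> (\<forall>t. norm (f (p + cscale t v)) \<le> A)"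
    unfolding bounded_iff by blast
  then show thesis
    using that not_le by blast
qed

lemma no_geometric_growth:
  fixes C r d q :: real and K :: nat
  assumes "q > 1" "C \<ge> 0" "r \<ge> 0" "d \<ge> 0" "a > 0"
    and "\<And>j :: nat. q ^ j * a \<le> C * (1 + r + real j * d) ^ K"
  shows False
proof -
  have "(\<lambda>j. C * (1 + r + real j * d) ^ K / q ^ j) \<longlonglongrightarrow> 0"
  proof (rule Lim_null_comparison)
    have "(\<lambda>j. real j ^ K * (1 / q) ^ j) \<longlonglongrightarrow> 0"
      using assms(1) by real_asymp
    then have "(\<lambda>j. (C * (1 + r + d) ^ K) * (real j ^ K * (1 / q) ^ j)) \<longlonglongrightarrow> (C * (1 + r + d) ^ K) * 0"
      by (intro tendsto_mult tendsto_const)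
    then show "(\<lambda>j. (C * (1 + r + d) ^ K) * (real j ^ K * (1 / q) ^ j)) \<longlonglongrightarrow> 0"
      by simp
    show "\<forall>\<^sub>F j in sequentially. norm (C * (1 + r + real j * d) ^ K / q ^ j)
        \<le> (C * (1 + r + d) ^ K) * (real j ^ K * (1 / q) ^ j)"
      using eventually_gt_at_top[of 0]
    proof eventually_elim
      case (elim j)
      then have "1 \<le> real j" by simp
      then have "1 + r + real j * d \<le> (1 + r + d) * real j"
        using assms(3) mult_left_mono[of 1 "real j" "1 + r"] by (simp add: algebra_simps)
      then have "C * (1 + r + real j * d) ^ K \<le> C * ((1 + r + d) * real j) ^ K"
        using assms by (intro mult_left_mono power_mono) auto
      then have "C * (1 + r + real j * d) ^ K / q ^ j \<le> C * ((1 + r + d) * real j) ^ K / q ^ j"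
        using assms(1) by (intro divide_right_mono) auto
      then show ?case
        using assms(1-4) by (simp add: power_mult_distrib power_divide mult.assoc)
    qed
  qed
  moreover have "a \<le> C * (1 + r + real j * d) ^ K / q ^ j" for j
    using assms(1) assms(6)[of j] by (simp add: field_simps)
  ultimately have "a \<le> 0"
    by (intro LIMSEQ_le_const) auto
  with assms(5) show False by simp
qed

text \<open>With \<open>z'\<close> a maximum point of \<open>norm (f q)\<close> on the ball of
  radius \<open>k\<close> about \<open>z - c\<close>, the equation gives
  \<open>y ^ m \<le> 1 + (2 * x) ^ n\<close>. Since \<open>m \<ge> n + 1\<close>, taking logarithms
  gains one extra \<open>ln y\<close>; half of it absorbs the constants and the other half is the
  growth factor.\<close>

lemma growth_step:
  fixes f G :: "complex \<times> complex \<Rightarrow> complex"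
  assumes cont: "continuous_on UNIV f" and mn: "m > n" "n \<ge> 1"
    and eq: "\<And>z. G z ^ n + f (z + c) ^ m = 1"
    and G: "\<And>z B. (\<And>q. dist z q \<le> k \<Longrightarrow> norm (f q) \<le> B) \<Longrightarrow> norm (G z) \<le> 2 * B"
    and k: "k \<ge> 0" and z: "norm (f z) \<ge> 2" and big: "ln (norm (f z)) \<ge> 4 * real n * ln 2"
  obtains z' where "norm z' \<le> norm z + (norm c + k)" "norm (f z') \<ge> 2"
    "ln (norm (f z')) \<ge> (1 + 1 / (2 * real n)) * ln (norm (f z))"
proof -
  have "\<exists>z'\<in>cball (z - c) k. \<forall>q\<in>cball (z - c) k. norm (f q) \<le> norm (f z')"
    using k by (intro continuous_attains_sup continuous_intros continuous_on_subset[OF cont]) auto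
  then obtain z' where z': "dist (z - c) z' \<le> k" "\<And>q. dist (z - c) q \<le> k \<Longrightarrow> norm (f q) \<le> norm (f z')"
    by auto
  define x where "x = norm (f z')"
  define y where "y = norm (f z)"
  have "y ^ m = norm (1 - G (z - c) ^ n)"
  proof -
    have "f z ^ m = 1 - G (z - c) ^ n"
      using eq[of "z - c"] by (simp add: algebra_simps)
    then show ?thesis
      unfolding y_def by (simp flip: norm_power)
  qed
  also have "\<dots> \<le> 1 + norm (G (z - c)) ^ n"
    using norm_triangle_ineq4[of 1 "G (z - c) ^ n"] by (simp add: norm_power)
  also have "\<dots> \<le> 1 + (2 * x) ^ n"
    using G[of "z - c" x] z'(2) by (intro add_left_mono power_mono) (auto simp: x_def)
  finally have le: "y ^ m \<le> 1 + (2 * x) ^ n" .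
  have y2: "y \<ge> 2" using z by (simp add: y_def)
  \<comment> \<open>\<open>y ^ m \<ge> 2\<close> lets half of \<open>y ^ m\<close> swallow the
    summand 1.\<close>
  have "2 ^ 1 \<le> (2 :: real) ^ m"
    using mn by (intro power_increasing) auto
  also have "\<dots> \<le> y ^ m"
    using y2 by (intro power_mono) auto
  finally have ym: "y ^ m / 2 \<le> (2 * x) ^ n"
    using le by simp
  moreover have "y ^ m > 0"
    using y2 by (intro zero_less_power) linarith
  ultimately have "x \<noteq> 0"
    using mn by (auto simp: power_0_left)
  then have x0: "x > 0" by (simp add: x_def)
  have "ln (y ^ m / 2) \<le> ln ((2 * x) ^ n)"
    using ym y2 x0 by (subst ln_le_cancel_iff) auto
  then have "m * ln y - ln 2 \<le> n * (ln 2 + ln x)"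
    using y2 x0 by (simp add: ln_div ln_realpow ln_mult distrib_left)
  moreover have "(n + 1) * ln y \<le> m * ln y"
    using mn y2 by (intro mult_right_mono) auto
  moreover have "(1::real) * ln 2 \<le> n * ln 2"
    using mn by (intro mult_right_mono) auto
  ultimately have "n * ln y + (ln y - 2 * n * ln 2) \<le> n * ln x"
    unfolding of_nat_add of_nat_1 distrib_left distrib_right by linarith
  moreover have "ln y / 2 \<le> ln y - 2 * n * ln 2"
    using big by (simp add: y_def)
  moreover have "n * ((1 + 1 / (2 * real n)) * ln y) = n * ln y + ln y / 2"
    using mn by (simp add: field_simps)
  ultimately have "n * ((1 + 1 / (2 * real n)) * ln y) \<le> n * ln x"
    by linarith
  then have ln: "(1 + 1 / (2 * real n)) * ln y \<le> ln x"
    using mn by simp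
  have "1 * ln y \<le> (1 + 1 / (2 * real n)) * ln y"
    using y2 by (intro mult_right_mono) auto
  then have "ln y \<le> ln x" using ln by simp
  then have "y \<le> x" using y2 x0 by simp
  show thesis
  proof
    have "norm z' \<le> norm (z - c) + k"
      using z'(1) norm_triangle_ineq2[of z' "z - c"] by (simp add: dist_norm norm_minus_commute)
    also have "norm (z - c) \<le> norm z + norm c"
      by (rule norm_triangle_ineq4)
    finally show "norm z' \<le> norm z + (norm c + k)" by simp
  qed (use \<open>y \<le> x\<close> y2 ln in \<open>auto simp: x_def y_def\<close>)
qed

lemma no_finite_order_solution_of_larger_power:
  assumes f: "line_holomorphic f" "finite_order f" and mn: "m > n" "n \<ge> 1"
    and eq: "\<And>z. G z ^ n + f (z + c) ^ m = 1"
    and G: "\<And>z B. (\<And>q. dist z q \<le> k \<Longrightarrow> norm (f q) \<le> B) \<Longrightarrow> norm (G z) \<le> 2 * B"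
    and k: "k \<ge> 0"
  shows "f p = f q"
proof (rule ccontr)
  assume "f p \<noteq> f q"
  \<comment> \<open>The two summands supply the two size conditions of \<open>growth_step\<close>;
    both persist along the iteration because \<open>Q > 1\<close>.\<close>
  then obtain w where w: "norm (f w) > exp (4 * real n * ln 2) + 2"
    using nonconstant_unbounded[OF f(1)] by blast
  obtain C :: real and K :: nat where C: "C \<ge> 0" "\<And>w. log_plus (norm (f w)) \<le> C * (1 + norm w) ^ K"
    using finite_order_growth[OF f] by blast
  define Q where "Q = 1 + 1 / (2 * real n)"
  have Q: "Q > 1" using mn by (simp add: Q_def)
  define d where "d = norm c + k"
  define a where "a = ln (norm (f w))"
  have "exp (4 * real n * ln 2) \<le> exp a"
  proof -
    have "norm (f w) > 0"
      using w exp_gt_zero[of "4 * real n * ln 2 :: real"] by linarith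
    then show ?thesis
      using w by (simp add: a_def)
  qed
  then have a: "a \<ge> 4 * real n * ln 2" by simp
  have w2: "norm (f w) \<ge> 2"
    using w by (smt (verit) exp_gt_zero)
  have a0: "a > 0"
    unfolding a_def using w2 by (intro ln_gt_zero) linarith
  have "\<exists>z. norm z \<le> norm w + real j * d \<and> norm (f z) \<ge> 2 \<and> ln (norm (f z)) \<ge> Q ^ j * a" for j
  proof (induction j)
    case 0
    show ?case using w2 by (intro exI[of _ w]) (simp add: a_def)
  next
    case (Suc j)
    then obtain z where z: "norm z \<le> norm w + real j * d" "norm (f z) \<ge> 2" "ln (norm (f z)) \<ge> Q ^ j * a"
      by blast
    have "1 * a \<le> Q ^ j * a"
      using Q a0 by (intro mult_right_mono one_le_power) auto
    then have big: "ln (norm (f z)) \<ge> 4 * real n * ln 2"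
      using a z(3) by simp
    obtain z' where z': "norm z' \<le> norm z + (norm c + k)" "norm (f z') \<ge> 2"
        "ln (norm (f z')) \<ge> (1 + 1 / (2 * real n)) * ln (norm (f z))"
      by (rule growth_step[OF line_holomorphicD(1)[OF f(1)] mn eq G k z(2) big])
    have "Q ^ Suc j * a \<le> Q * ln (norm (f z))"
      using z(3) Q by (simp add: mult.assoc)
    then show ?case
      using z z' by (intro exI[of _ z']) (simp add: Q_def d_def algebra_simps)
  qed
  note iter = this
  have "Q ^ j * a \<le> C * (1 + norm w + real j * d) ^ K" for j
  proof -
    obtain z where z: "norm z \<le> norm w + real j * d" "ln (norm (f z)) \<ge> Q ^ j * a"
      using iter by blast
    have "Q ^ j * a \<le> log_plus (norm (f z))"
      using z(2) by (simp add: log_plus_def)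
    also have "\<dots> \<le> C * (1 + norm z) ^ K"
      by (rule C)
    also have "\<dots> \<le> C * (1 + norm w + real j * d) ^ K"
      using z(1) C(1) by (intro mult_left_mono power_mono) auto
    finally show ?thesis .
  qed
  from no_geometric_growth[OF Q C(1) _ _ a0 this] show False
    using k by (simp add: d_def)
qed

theorem theorem1p2:
  fixes c1 c2 :: complex and m n :: nat and I J :: "nat \<times> nat"
  assumes "m \<ge> 1" and "n \<ge> 1"
    and "m > n \<or> (n > m \<and> m \<ge> 2)"
  shows "\<not> (\<exists>f :: complex \<times> complex \<Rightarrow> complex.
            transcendental_entire2 f \<and> finite_order f \<and>
            (\<forall>z1 z2. (partial_deriv I f (z1, z2) + partial_deriv J f (z1, z2)) ^ n
                       + (f (z1 + c1, z2 + c2)) ^ m = 1))"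
proof
  assume "\<exists>f. transcendental_entire2 f \<and> finite_order f \<and>
            (\<forall>z1 z2. (partial_deriv I f (z1, z2) + partial_deriv J f (z1, z2)) ^ n
                       + (f (z1 + c1, z2 + c2)) ^ m = 1)"
  then obtain f where ent: "entire2 f" and nonpoly: "\<not> polynomial2 f" and ord: "finite_order f"
    and eq: "\<And>z1 z2. (partial_deriv I f (z1, z2) + partial_deriv J f (z1, z2)) ^ n
                       + (f (z1 + c1, z2 + c2)) ^ m = 1"
    unfolding transcendental_entire2_def by blast
  define G where "G z = partial_deriv I f z + partial_deriv J f z" for z
  define c where "c = (c1, c2)"
  have Geq: "G z ^ n + f (z + c) ^ m = 1" for z
    using eq[of "fst z" "snd z"] by (simp add: G_def c_def plus_prod_def)
  have f: "line_holomorphic f"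
    by (rule entire2_imp_line_holomorphic[OF ent])
  have "f p = f q" for p q
    using assms(3)
  proof
    assume "m > n"
    \<comment> \<open>A single radius that covers the Cauchy estimates of both derivatives.\<close>
    define k where "k = real (fst I + snd I + fst J + snd J)"
    have bound: "norm (G z) \<le> 2 * B" if B: "\<And>q. dist z q \<le> k \<Longrightarrow> norm (f q) \<le> B" for z B
    proof -
      have "norm (partial_deriv I f z) \<le> B" "norm (partial_deriv J f z) \<le> B"
        by (rule partial_deriv_bound[OF f]; rule B; simp add: k_def)+
      then show ?thesis
        unfolding G_def using norm_triangle_ineq[of "partial_deriv I f z" "partial_deriv J f z"] by simp
    qed
    show "f p = f q"
      by (rule no_finite_order_solution_of_larger_power[OF f ord \<open>m > n\<close> assms(2) Geq, of k])
         (use bound in \<open>auto simp: k_def\<close>)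
  next
    assume nm: "n > m \<and> m \<ge> 2"
    show "f p = f q"
    proof (rule ccontr)
      assume "f p \<noteq> f q"
      then obtain v where v: "\<not> (\<lambda>t. f (p + cscale t v)) constant_on UNIV"
        by (rule nonconstant_on_line)
      \<comment> \<open>\<open>G\<close> is taken on the line through \<open>p - c\<close>, so that
        the shifted \<open>f\<close> runs along the line through \<open>p\<close> on which it is not
        constant.\<close>
      have "(\<lambda>t. G (p - c + cscale t v)) holomorphic_on UNIV"
        unfolding G_def by (intro holomorphic_intros line_holomorphicD(2) line_holomorphic_partial_deriv f)
      moreover have "(\<lambda>t. f (p + cscale t v)) holomorphic_on UNIV"
        by (rule line_holomorphicD(2)[OF f])
      moreover have "G (p - c + cscale t v) ^ n + f (p + cscale t v) ^ m = 1" for t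
        using Geq[of "p - c + cscale t v"] by (simp add: algebra_simps)
      ultimately show False
        using entire_power_sum_eq_1_imp_const[of "\<lambda>t. G (p - c + cscale t v)" "\<lambda>t. f (p + cscale t v)" n m]
          nm v by auto
    qed
  qed
  then have "f (z1, z2) = (\<Sum>i\<le>0::nat. \<Sum>j\<le>0::nat. f 0 * z1 ^ i * z2 ^ j)" for z1 z2
    by simp
  then have "polynomial2 f"
    unfolding polynomial2_def by (intro exI[of _ 0] exI[of _ "\<lambda>_ _. f 0"]) blast
  with nonpoly show False by contradiction
qed

end
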